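(* Let $f=\sum_{S\subseteq[n]}c_S\prod_{i\in S}x_i$ be a homogeneous degree-$k$ multiaffine polynomial with nonnegative coefficients that is strongly log-concave at $\mathbb{1}$. Then for every $0\leqslant\alpha\leqslant1$, the polynomial $f_\alpha=\sum_{S\subseteq[n]}c_S^\alpha\prod_{i\in S}x_i$ is strongly log-concave at $\mathbb{1}$.
   Context: Convention: $c_S^\alpha$ is taken to be $0$ whenever $c_S=0$ (also for $\alpha=0$). A polynomial $p$ with nonnegative coefficients is log-concave at $\mathbb{1}=(1,\dots,1)$ if it is identically zero or the Hessian of $\log p$ at $\mathbb{1}$ is negative semidefinite; it is strongly log-concave at $\mathbb{1}$ if for every $m\geqslant0$ and all $1\leqslant i_1,\dots,i_m\leqslant n$ (repetitions allowed), $\partial_{i_1}\cdots\partial_{i_m}p$ is log-concave at $\mathbb{1}$. *)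

theory Defs
  imports "HOL-Analysis.Analysis"
begin

text \<open>
  A real polynomial in \<open>x\<^sub>1, \<dots>, x\<^sub>n\<close> is represented by its polynomial function on points
  \<open>x :: nat \<Rightarrow> real\<close>, of which only the coordinates in \<open>{1..n}\<close> matter.
\<close>

definition partial_deriv :: "nat \<Rightarrow> ((nat \<Rightarrow> real) \<Rightarrow> real) \<Rightarrow> (nat \<Rightarrow> real) \<Rightarrow> real" where
  "partial_deriv i p x = deriv (\<lambda>t. p (x(i := t))) (x i)"

definition hessian :: "((nat \<Rightarrow> real) \<Rightarrow> real) \<Rightarrow> (nat \<Rightarrow> real) \<Rightarrow> nat \<Rightarrow> nat \<Rightarrow> real" where
  "hessian g x i j = partial_deriv i (partial_deriv j g) x"

definition neg_semidefinite :: "nat \<Rightarrow> (nat \<Rightarrow> nat \<Rightarrow> real) \<Rightarrow> bool" where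
  "neg_semidefinite n A \<longleftrightarrow>
     (\<forall>v :: nat \<Rightarrow> real. (\<Sum>i=1..n. \<Sum>j=1..n. v i * A i j * v j) \<le> 0)"

text \<open>
  A nonzero polynomial with nonnegative coefficients is positive near the all-ones point, so the
  value of \<^const>\<open>ln\<close> at nonpositive arguments plays no role for the polynomials considered.
\<close>

definition log_concave_at_one :: "nat \<Rightarrow> ((nat \<Rightarrow> real) \<Rightarrow> real) \<Rightarrow> bool" where
  "log_concave_at_one n p \<longleftrightarrow>
     (\<forall>x. p x = 0) \<or> neg_semidefinite n (hessian (\<lambda>x. ln (p x)) (\<lambda>_. 1))"

definition strongly_log_concave_at_one :: "nat \<Rightarrow> ((nat \<Rightarrow> real) \<Rightarrow> real) \<Rightarrow> bool" where
  "strongly_log_concave_at_one n p \<longleftrightarrow>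
     (\<forall>is. set is \<subseteq> {1..n} \<longrightarrow> log_concave_at_one n (foldr partial_deriv is p))"

definition multiaffine_poly :: "nat \<Rightarrow> (nat set \<Rightarrow> real) \<Rightarrow> (nat \<Rightarrow> real) \<Rightarrow> real" where
  "multiaffine_poly n c x = (\<Sum>S\<in>Pow {1..n}. c S * (\<Prod>i\<in>S. x i))"

text \<open>
  Powers of coefficients are taken with \<^const>\<open>powr\<close>, for which \<open>0 powr a = 0\<close> for every \<open>a\<close>,
  including \<open>a = 0\<close>.
\<close>

end

theory Submission
  imports Defs
begin

text \<open>
  For a homogeneous polynomial with nonnegative coefficients, log-concavity at the all-ones point
  means that the Hessian there is negative semidefinite on the hyperplane orthogonal to the
  gradient. The theorem follows by induction on the degree \<open>k\<close>.

  For \<open>k = 2\<close>, let \<open>a\<close> be the Hessian, \<open>w\<close> its vector of row sums and \<open>s\<close> the sum of its entries.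
  Log-concavity says that \<open>N i j = 1 - s * a i j / (w i * w j)\<close> is positive semidefinite; its
  diagonal entries are 1 because the polynomial is multiaffine. All nonconstant coefficients of the
  binomial series of \<open>(1 - z) powr \<alpha>\<close> are nonpositive, so the Schur product theorem makes the
  matrix of \<open>(1 - N i j) powr \<alpha>\<close> negative semidefinite on vectors of sum zero.

  For \<open>k \<ge> 3\<close>, the derivatives of \<open>f\<^sub>\<alpha>\<close> are log-concave by induction, and log-concavity of \<open>f\<^sub>\<alpha>\<close>
  follows by Oppenheim's trickle-down argument: with \<open>D\<close> the diagonal matrix of the gradient,
  every eigenvalue \<open>\<mu> > 0\<close> of \<open>H v = \<mu> D v\<close> satisfies \<open>\<mu> \<ge> k - 1\<close>, whereas \<open>k - 1\<close> is the largest
  eigenvalue and is simple when the graph of nonzero entries of \<open>H\<close> is connected. That graph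
  depends only on the support, and it is connected for \<open>f\<close> because \<open>f\<close> is log-concave.
\<close>

section \<open>Hadamard powers of quadratic forms\<close>

definition qform :: "'a set \<Rightarrow> ('a \<Rightarrow> 'a \<Rightarrow> real) \<Rightarrow> ('a \<Rightarrow> real) \<Rightarrow> real" where
  "qform I A v = (\<Sum>i\<in>I. \<Sum>j\<in>I. v i * A i j * v j)"

lemma qform_cong:
  assumes "\<And>i j. i \<in> I \<Longrightarrow> j \<in> I \<Longrightarrow> v i * A i j * v j = w i * B i j * w j"
  shows "qform I A v = qform I B w"
  unfolding qform_def using assms by (intro sum.cong refl) auto

lemma qform_mono_neutral:
  assumes "finite I" "J \<subseteq> I"
    and "\<And>i j. i \<in> I \<Longrightarrow> j \<in> I \<Longrightarrow> i \<notin> J \<or> j \<notin> J \<Longrightarrow> v i * A i j * v j = 0"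
  shows "qform I A v = qform J A v"
proof -
  have "qform I A v = (\<Sum>i\<in>J. \<Sum>j\<in>I. v i * A i j * v j)"
    unfolding qform_def using assms by (intro sum.mono_neutral_right) (auto intro!: sum.neutral)
  also have "\<dots> = qform J A v"
    unfolding qform_def using assms by (intro sum.cong sum.mono_neutral_right) auto
  finally show ?thesis .
qed

lemma qform_alt: "qform I A v = (\<Sum>i\<in>I. v i * (\<Sum>j\<in>I. A i j * v j))"
  unfolding qform_def by (simp add: sum_distrib_left mult.assoc)

lemma qform_cmult: "qform I (\<lambda>i j. r * A i j) v = r * qform I A v"
  unfolding qform_def by (simp add: sum_distrib_left mult_ac)

lemma qform_const: "qform I (\<lambda>i j. 1) v = (sum v I)\<^sup>2"
  unfolding qform_def by (simp add: power2_eq_square sum_product)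

lemma qform_add:
  assumes "\<And>i j. i \<in> I \<Longrightarrow> j \<in> I \<Longrightarrow> A i j = A j i"
  shows "qform I A (\<lambda>i. v i + t * w i)
    = qform I A v + 2 * t * (\<Sum>i\<in>I. w i * (\<Sum>j\<in>I. A i j * v j)) + t\<^sup>2 * qform I A w"
proof -
  have sw: "(\<Sum>i\<in>I. \<Sum>j\<in>I. v i * A i j * w j) = (\<Sum>i\<in>I. \<Sum>j\<in>I. w i * A i j * v j)"
    by (subst sum.swap) (intro sum.cong refl, simp add: assms)
  have "qform I A (\<lambda>i. v i + t * w i) = qform I A v
      + t * (\<Sum>i\<in>I. \<Sum>j\<in>I. v i * A i j * w j) + t * (\<Sum>i\<in>I. \<Sum>j\<in>I. w i * A i j * v j)
      + t\<^sup>2 * qform I A w"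
    unfolding qform_def
    by (simp add: sum_distrib_left sum.distrib[symmetric] power2_eq_square algebra_simps)
  then show ?thesis
    unfolding sw by (simp add: sum_distrib_left mult_ac)
qed

lemma quadratic_nonneg_discriminant:
  fixes a b c :: real
  assumes "0 \<le> a" and *: "\<And>t. 0 \<le> a * t\<^sup>2 + 2 * b * t + c"
  shows "b\<^sup>2 \<le> a * c"
proof (cases "a = 0")
  case True
  have "b = 0"
  proof (rule ccontr)
    assume "b \<noteq> 0"
    then show False using *[of "-(c + 1) / (2 * b)"] True by (simp add: field_simps)
  qed
  then show ?thesis using True by simp
next
  case False
  then have "a > 0" using assms by simp
  then show ?thesis using *[of "-b / a"] by (simp add: field_simps power2_eq_square)
qed

lemma qform_insert:
  assumes "finite F" "a \<notin> F" "\<And>j. j \<in> F \<Longrightarrow> M j a = M a j"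
  shows "qform (insert a F) M v
    = M a a * (v a)\<^sup>2 + 2 * (\<Sum>j\<in>F. M a j * v j) * v a + qform F M v"
  using assms unfolding qform_def
  by (simp add: sum.distrib sum_distrib_left sum_distrib_right power2_eq_square mult_ac
      algebra_simps)

lemma psd_gram:
  fixes M :: "'a \<Rightarrow> 'a \<Rightarrow> real"
  assumes "finite I" "\<And>i j. i \<in> I \<Longrightarrow> j \<in> I \<Longrightarrow> M i j = M j i" "\<And>v. 0 \<le> qform I M v"
  shows "\<exists>(m::nat) x. \<forall>i\<in>I. \<forall>j\<in>I. M i j = (\<Sum>l<m. x l i * x l j)"
  using assms
proof (induction I arbitrary: M rule: finite_induct)
  case empty
  then show ?case by simp
next
  case (insert a F)
  have exp: "qform (insert a F) M v
      = M a a * (v a)\<^sup>2 + 2 * (\<Sum>j\<in>F. M a j * v j) * v a + qform F M v" for v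
    using insert by (intro qform_insert) auto
  have upd: "0 \<le> M a a * t\<^sup>2 + 2 * (\<Sum>j\<in>F. M a j * v j) * t + qform F M v" for v t
  proof -
    have "0 \<le> qform (insert a F) M (v(a := t))" by (rule insert.prems(2))
    moreover have "qform F M (v(a := t)) = qform F M v"
      using insert.hyps by (intro qform_cong) auto
    moreover have "(\<Sum>j\<in>F. M a j * (v(a := t)) j) = (\<Sum>j\<in>F. M a j * v j)"
      using insert.hyps by (intro sum.cong) auto
    ultimately show ?thesis unfolding exp by simp
  qed
  have Maa: "0 \<le> M a a" using upd[of 1 "\<lambda>_. 0"] by (simp add: qform_def)
  have disc: "(\<Sum>j\<in>F. M a j * v j)\<^sup>2 \<le> M a a * qform F M v" for v
    using quadratic_nonneg_discriminant[OF Maa] upd by blast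
  have zero: "M a j = 0" if "M a a = 0" "j \<in> F" for j
  proof -
    have "(\<Sum>j\<in>F. M a j * M a j) = 0" using disc[of "M a"] that by simp
    then have "\<forall>j\<in>F. M a j * M a j = 0"
      using insert.hyps by (subst (asm) sum_nonneg_eq_0_iff) auto
    with that show ?thesis by simp
  qed
  \<comment> \<open>Schur complement of \<open>M a a\<close>; if \<open>M a a = 0\<close>, then row \<open>a\<close> vanishes and \<open>x / 0 = 0\<close> gives \<open>M' = M\<close>.\<close>
  define M' where "M' i j = M i j - M a i * M a j / M a a" for i j
  have "qform F M' v = qform F M v - (\<Sum>j\<in>F. M a j * v j)\<^sup>2 / M a a" for v
    unfolding qform_def M'_def power2_eq_square sum_product
    by (simp add: sum_divide_distrib sum_subtractf[symmetric] algebra_simps diff_divide_distrib)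
  moreover have "(\<Sum>j\<in>F. M a j * v j)\<^sup>2 / M a a \<le> qform F M v" for v
    using disc[of v] upd[of 0 v] Maa by (cases "M a a = 0") (auto simp: divide_le_eq mult.commute)
  ultimately have "0 \<le> qform F M' v" for v by simp
  moreover have "M' i j = M' j i" if "i \<in> F" "j \<in> F" for i j
    using insert.prems(1)[of i j] that by (simp add: M'_def mult.commute)
  ultimately obtain m :: nat and x where x: "\<forall>i\<in>F. \<forall>j\<in>F. M' i j = (\<Sum>l<m. x l i * x l j)"
    using insert.IH[of M'] by blast
  define y where "y l i = (if l < m then if i = a then 0 else x l i else M a i / sqrt (M a a))"
    for l i
  have "M i j = (\<Sum>l<Suc m. y l i * y l j)" if "i \<in> insert a F" "j \<in> insert a F" for i j
  proof -
    have "(\<Sum>l<Suc m. y l i * y l j)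
        = (\<Sum>l<m. if i = a \<or> j = a then 0 else x l i * x l j) + M a i * M a j / M a a"
      using Maa by (auto simp: y_def intro!: sum.cong)
    also have "\<dots> = (if i = a \<or> j = a then 0 else M' i j) + M a i * M a j / M a a"
      using x that by auto
    also have "\<dots> = M i j"
      using zero that insert.prems(1)[of i a] by (cases "M a a = 0") (auto simp: M'_def)
    finally show ?thesis by simp
  qed
  then show ?case by blast
qed

lemma psd_hadamard_power:
  fixes M :: "'a \<Rightarrow> 'a \<Rightarrow> real"
  assumes "finite I" "\<And>i j. i \<in> I \<Longrightarrow> j \<in> I \<Longrightarrow> M i j = M j i" "\<And>v. 0 \<le> qform I M v"
  shows "0 \<le> qform I (\<lambda>i j. M i j ^ k) v"
proof -
  obtain m :: nat and x where x: "\<forall>i\<in>I. \<forall>j\<in>I. M i j = (\<Sum>l<m. x l i * x l j)"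
    using psd_gram[OF assms] by blast
  show ?thesis
  proof (induction k arbitrary: v)
    case 0
    show ?case by (simp add: qform_const)
  next
    case (Suc k)
    have "qform I (\<lambda>i j. M i j ^ Suc k) v
        = (\<Sum>i\<in>I. \<Sum>j\<in>I. \<Sum>l<m. (x l i * v i) * M i j ^ k * (x l j * v j))"
      unfolding qform_def using x
      by (intro sum.cong refl) (simp add: sum_distrib_left sum_distrib_right mult_ac)
    also have "\<dots> = (\<Sum>i\<in>I. \<Sum>l<m. \<Sum>j\<in>I. (x l i * v i) * M i j ^ k * (x l j * v j))"
      by (intro sum.cong refl sum.swap)
    also have "\<dots> = (\<Sum>l<m. qform I (\<lambda>i j. M i j ^ k) (\<lambda>i. x l i * v i))"
      unfolding qform_def by (rule sum.swap)
    finally show ?case using Suc by (simp add: sum_nonneg)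
  qed
qed

lemma gbinomial_alternating_nonpos:
  fixes \<alpha> :: real
  assumes "0 \<le> \<alpha>" "\<alpha> \<le> 1"
  shows "(\<alpha> gchoose Suc k) * (-1) ^ Suc k \<le> 0"
proof (induction k)
  case 0
  then show ?case using assms by simp
next
  case (Suc k)
  have "\<alpha> gchoose Suc (Suc k) = (\<alpha> gchoose Suc k) * ((\<alpha> - real (Suc k)) / real (Suc (Suc k)))"
    unfolding gbinomial_prod_rev by (simp add: field_simps)
  moreover have "(real (Suc k) - \<alpha>) / real (Suc (Suc k))
      = - ((\<alpha> - real (Suc k)) / real (Suc (Suc k)))"
    by (simp only: minus_divide_left minus_diff_eq)
  ultimately have "(\<alpha> gchoose Suc (Suc k)) * (-1) ^ Suc (Suc k)
      = ((\<alpha> gchoose Suc k) * (-1) ^ Suc k) * ((real (Suc k) - \<alpha>) / real (Suc (Suc k)))"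
    by simp
  also have "\<dots> \<le> 0" using Suc assms by (intro mult_nonpos_nonneg[of "_ * _" "_ / _"]) auto
  finally show ?case .
qed

lemma qform_one_minus_powr_nonpos_if_pos:
  fixes N :: "'a \<Rightarrow> 'a \<Rightarrow> real"
  assumes "finite I" "\<And>i j. i \<in> I \<Longrightarrow> j \<in> I \<Longrightarrow> N i j = N j i" "\<And>v. 0 \<le> qform I N v"
    and le1: "\<And>i j. i \<in> I \<Longrightarrow> j \<in> I \<Longrightarrow> \<bar>N i j\<bar> \<le> 1"
    and \<alpha>: "0 < \<alpha>" "\<alpha> \<le> 1" and "sum v I = 0"
  shows "qform I (\<lambda>i j. (1 - N i j) powr \<alpha>) v \<le> 0"
proof -
  have *: "qform I (\<lambda>i j. (1 - r * N i j) powr \<alpha>) v \<le> 0" if r: "0 < r" "r < 1" for r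
  proof -
    have "(\<lambda>k. (\<alpha> gchoose k) * (- (r * N i j)) ^ k) sums (1 - r * N i j) powr \<alpha>"
      if "i \<in> I" "j \<in> I" for i j
    proof -
      have "\<bar>r * N i j\<bar> < 1"
        using le1[OF that] r by (simp add: abs_mult) (smt (verit) mult_left_le)
      then show ?thesis using gen_binomial_real[of "- (r * N i j)" \<alpha>] by simp
    qed
    then have "(\<lambda>k. qform I (\<lambda>i j. (\<alpha> gchoose k) * (- (r * N i j)) ^ k) v) sums
        qform I (\<lambda>i j. (1 - r * N i j) powr \<alpha>) v"
      unfolding qform_def by (intro sums_sum sums_mult sums_mult2) auto
    moreover have "qform I (\<lambda>i j. (\<alpha> gchoose k) * (- (r * N i j)) ^ k) v \<le> 0" for k
    proof (cases k)
      case 0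
      then show ?thesis using qform_const[of I v] assms by simp
    next
      case (Suc l)
      have "qform I (\<lambda>i j. (\<alpha> gchoose k) * (- (r * N i j)) ^ k) v
          = ((\<alpha> gchoose k) * (-1) ^ k) * (r ^ k * qform I (\<lambda>i j. N i j ^ k) v)"
        unfolding qform_cmult[symmetric]
        by (intro qform_cong) (simp add: power_mult_distrib power_minus[of "r * _"] mult_ac)
      also have "\<dots> \<le> 0"
        using gbinomial_alternating_nonpos[of \<alpha> l] \<alpha> r psd_hadamard_power[OF assms(1-3), of "Suc l" v]
        unfolding Suc by (intro mult_nonpos_nonneg[of "_ * _" "_ * _"] mult_nonneg_nonneg) simp_all
      finally show ?thesis .
    qed
    ultimately show ?thesis by (rule sums_le[OF _ _ sums_zero, rotated])
  qed
  have "((\<lambda>r. qform I (\<lambda>i j. (1 - r * N i j) powr \<alpha>) v) \<longlongrightarrow>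
      qform I (\<lambda>i j. (1 - 1 * N i j) powr \<alpha>) v) (at_left 1)"
    unfolding qform_def
  proof (intro tendsto_sum tendsto_mult tendsto_const)
    fix i j assume ij: "i \<in> I" "j \<in> I"
    have "\<forall>\<^sub>F r in at_left 1. 0 \<le> 1 - r * N i j"
      using eventually_at_left_real[OF zero_less_one]
    proof (rule eventually_mono)
      fix r :: real assume "r \<in> {0<..<1}"
      then have r: "0 < r" "r < 1" by auto
      then have "r * N i j \<le> r * 1" using le1[OF ij] by (intro mult_left_mono) auto
      then show "0 \<le> 1 - r * N i j" using r by linarith
    qed
    then show "((\<lambda>r. (1 - r * N i j) powr \<alpha>) \<longlongrightarrow> (1 - 1 * N i j) powr \<alpha>) (at_left 1)"
      using \<alpha> by (intro tendsto_powr2 tendsto_intros) auto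
  qed
  moreover have "\<forall>\<^sub>F r in at_left 1. qform I (\<lambda>i j. (1 - r * N i j) powr \<alpha>) v \<le> 0"
    using eventually_at_left_real[OF zero_less_one]
    by (rule eventually_mono) (use * in auto)
  ultimately show ?thesis
    using tendsto_upperbound[of _ _ "at_left (1::real)"] by force
qed

lemma qform_one_minus_powr_nonpos:
  fixes N :: "'a \<Rightarrow> 'a \<Rightarrow> real"
  assumes "finite I" "\<And>i j. i \<in> I \<Longrightarrow> j \<in> I \<Longrightarrow> N i j = N j i" "\<And>v. 0 \<le> qform I N v"
    and le1: "\<And>i j. i \<in> I \<Longrightarrow> j \<in> I \<Longrightarrow> \<bar>N i j\<bar> \<le> 1"
    and \<alpha>: "0 \<le> \<alpha>" "\<alpha> \<le> 1" and "sum v I = 0"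
  shows "qform I (\<lambda>i j. (1 - N i j) powr \<alpha>) v \<le> 0"
proof (cases "\<alpha> = 0")
  case False
  then show ?thesis using assms by (intro qform_one_minus_powr_nonpos_if_pos) auto
next
  case True
  have pw: "((\<lambda>\<beta>. x powr \<beta>) \<longlongrightarrow> x powr 0) (at_right 0)" for x :: real
    by (cases "x = 0") (auto intro!: tendsto_eq_intros)
  have "((\<lambda>\<beta>. qform I (\<lambda>i j. (1 - N i j) powr \<beta>) v) \<longlongrightarrow> qform I (\<lambda>i j. (1 - N i j) powr 0) v)
      (at_right 0)"
    unfolding qform_def by (intro tendsto_intros pw)
  moreover have "\<forall>\<^sub>F \<beta> in at_right 0. qform I (\<lambda>i j. (1 - N i j) powr \<beta>) v \<le> 0"
    using eventually_at_right_real[OF zero_less_one]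
    by (rule eventually_mono) (use assms in \<open>auto intro!: qform_one_minus_powr_nonpos_if_pos\<close>)
  ultimately show ?thesis
    unfolding True using tendsto_upperbound[of _ _ "at_right (0::real)"] by force
qed

lemma sum_weighted_row_sums:
  fixes a :: "'a \<Rightarrow> 'a \<Rightarrow> real"
  assumes "\<And>i j. i \<in> I \<Longrightarrow> j \<in> I \<Longrightarrow> a i j = a j i"
  shows "(\<Sum>i\<in>I. \<Sum>j\<in>I. a i j * v j) = (\<Sum>i\<in>I. v i * (\<Sum>j\<in>I. a i j))"
  by (subst sum.swap) (simp add: sum_distrib_left assms mult.commute cong: sum.cong)

lemma hadamard_powr_nsd:
  fixes a :: "'a \<Rightarrow> 'a \<Rightarrow> real"
  assumes fin: "finite I"
    and sym: "\<And>i j. i \<in> I \<Longrightarrow> j \<in> I \<Longrightarrow> a i j = a j i"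
    and nonneg: "\<And>i j. i \<in> I \<Longrightarrow> j \<in> I \<Longrightarrow> 0 \<le> a i j"
    and diag: "\<And>i. i \<in> I \<Longrightarrow> a i i = 0"
    and nsd: "\<And>v. (\<Sum>i\<in>I. v i * (\<Sum>j\<in>I. a i j)) = 0 \<Longrightarrow> qform I a v \<le> 0"
    and \<alpha>: "0 \<le> \<alpha>" "\<alpha> \<le> 1"
    and v: "(\<Sum>i\<in>I. v i * (\<Sum>j\<in>I. a i j powr \<alpha>)) = 0"
  shows "qform I (\<lambda>i j. a i j powr \<alpha>) v \<le> 0"
proof -
  define w where "w i = (\<Sum>j\<in>I. a i j)" for i
  define s where "s = sum w I"
  define V where "V = {i\<in>I. w i > 0}"
  have w0: "0 \<le> w i" if "i \<in> I" for i
    using nonneg that by (auto simp: w_def intro!: sum_nonneg)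
  have VI: "V \<subseteq> I" "finite V" using fin by (auto simp: V_def)
  have off: "a i j = 0" if "i \<in> I" "j \<in> I" "i \<notin> V \<or> j \<notin> V" for i j
  proof -
    have *: "a i j = 0" if "i \<in> I" "j \<in> I" "i \<notin> V" for i j
    proof -
      have "w i = 0" using w0 that by (force simp: V_def)
      then show ?thesis
        unfolding w_def using nonneg that fin by (subst (asm) sum_nonneg_eq_0_iff) auto
    qed
    then show ?thesis using that sym by metis
  qed
  show ?thesis
  proof (cases "V = {}")
    case True
    then have "qform I (\<lambda>i j. a i j powr \<alpha>) v = 0"
      unfolding qform_def using off by (intro sum.neutral ballI) auto
    then show ?thesis by simp
  next
    case False
    have "sum w V > 0" using False VI by (intro sum_pos) (auto simp: V_def)
    moreover have "sum w V \<le> s" unfolding s_def using VI fin w0 by (intro sum_mono2) auto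
    ultimately have s: "s > 0" by simp
    define N where "N i j = 1 - s * (a i j / (w i * w j))" for i j
    have Nsym: "N i j = N j i" if "i \<in> V" "j \<in> V" for i j
      using sym[of i j] that VI by (auto simp: N_def mult.commute)
    have psd: "0 \<le> qform V N u" for u
    proof -
      define x where "x i = (if i \<in> V then u i / w i else 0)" for i
      define \<sigma> where "\<sigma> = sum u V"
      have q: "qform I a x = qform V (\<lambda>i j. a i j / (w i * w j)) u"
      proof -
        have "qform I a x = qform V a x"
          using fin VI by (intro qform_mono_neutral) (auto simp: x_def)
        also have "\<dots> = qform V (\<lambda>i j. a i j / (w i * w j)) u"
          by (intro qform_cong) (auto simp: x_def)
        finally show ?thesis .
      qed
      have \<sigma>: "(\<Sum>i\<in>I. x i * w i) = \<sigma>"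
      proof -
        have "(\<Sum>i\<in>I. x i * w i) = (\<Sum>i\<in>V. x i * w i)"
          using fin VI by (intro sum.mono_neutral_right) (auto simp: x_def)
        also have "\<dots> = \<sigma>" unfolding \<sigma>_def by (intro sum.cong) (auto simp: x_def V_def)
        finally show ?thesis .
      qed
      have "(\<Sum>i\<in>I. (x i + (- \<sigma> / s) * 1) * w i) = (\<Sum>i\<in>I. x i * w i) + (- \<sigma> / s) * s"
        unfolding s_def sum_distrib_left sum.distrib[symmetric] by (simp add: algebra_simps)
      also have "\<dots> = 0" using \<sigma> s by simp
      finally have "qform I a (\<lambda>i. x i + (- \<sigma> / s) * 1) \<le> 0" unfolding w_def by (rule nsd)
      moreover have "qform I a (\<lambda>i. x i + (- \<sigma> / s) * 1)
          = qform I a x + 2 * (- \<sigma> / s) * (\<Sum>i\<in>I. 1 * (\<Sum>j\<in>I. a i j * x j))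
            + (- \<sigma> / s)\<^sup>2 * qform I a (\<lambda>_. 1)"
        by (rule qform_add) (rule sym)
      moreover have "qform I a (\<lambda>_. 1) = s" by (simp add: qform_def s_def w_def)
      moreover have "(\<Sum>i\<in>I. 1 * (\<Sum>j\<in>I. a i j * x j)) = \<sigma>"
        using sum_weighted_row_sums[of I a x] sym \<sigma> unfolding w_def by simp
      ultimately have "qform I a x + 2 * (- \<sigma> / s) * \<sigma> + (- \<sigma> / s)\<^sup>2 * s \<le> 0" by simp
      then have "s * qform I a x \<le> \<sigma>\<^sup>2"
        using s by (simp add: field_simps power2_eq_square)
      moreover have "qform V N u = \<sigma>\<^sup>2 - s * qform I a x"
        unfolding q \<sigma>_def qform_const[symmetric] qform_cmult[symmetric]
        unfolding qform_def N_def by (simp add: sum_subtractf[symmetric] algebra_simps)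
      ultimately show ?thesis by simp
    qed
    have Nii: "N i i = 1" if "i \<in> V" for i using that diag VI by (auto simp: N_def)
    have N1: "\<bar>N i j\<bar> \<le> 1" if "i \<in> V" "j \<in> V" for i j
    proof -
      obtain m :: nat and x where x: "\<forall>i\<in>V. \<forall>j\<in>V. N i j = (\<Sum>l<m. x l i * x l j)"
        using psd_gram[of V N] VI Nsym psd by blast
      have "(N i j)\<^sup>2 \<le> N i i * N j j"
        using Cauchy_Schwarz_ineq_sum[of "\<lambda>l. x l i" "\<lambda>l. x l j" "{..<m}"] x that
        by (simp add: power2_eq_square)
      then show ?thesis using Nii that by (simp add: abs_square_le_1)
    qed
    define z where "z i = w i powr \<alpha>" for i
    have zpos: "sum z V > 0" using False VI by (intro sum_pos) (auto simp: V_def z_def)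
    define t where "t = - (\<Sum>i\<in>V. z i * v i) / sum z V"
    have "(\<Sum>i\<in>V. z i * (v i + t * 1)) = (\<Sum>i\<in>V. z i * v i) + t * sum z V"
      unfolding sum_distrib_left sum.distrib[symmetric] by (simp add: algebra_simps)
    also have "\<dots> = 0" using zpos by (simp add: t_def)
    finally have "qform V (\<lambda>i j. (1 - N i j) powr \<alpha>) (\<lambda>i. z i * (v i + t * 1)) \<le> 0"
      using VI Nsym psd N1 \<alpha> by (intro qform_one_minus_powr_nonpos) auto
    also have "qform V (\<lambda>i j. (1 - N i j) powr \<alpha>) (\<lambda>i. z i * (v i + t * 1))
        = qform V (\<lambda>i j. s powr \<alpha> * a i j powr \<alpha>) (\<lambda>i. v i + t * 1)"
    proof (intro qform_cong)
      fix i j assume "i \<in> V" "j \<in> V"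
      then have "w i > 0" "w j > 0" "a i j \<ge> 0" using nonneg by (auto simp: V_def)
      then show "z i * (v i + t * 1) * (1 - N i j) powr \<alpha> * (z j * (v j + t * 1)) =
          (v i + t * 1) * (s powr \<alpha> * a i j powr \<alpha>) * (v j + t * 1)"
        using s by (simp add: N_def z_def powr_mult powr_divide)
    qed
    also have "\<dots> = s powr \<alpha> * qform V (\<lambda>i j. a i j powr \<alpha>) (\<lambda>i. v i + t * 1)"
      by (rule qform_cmult)
    also have "qform V (\<lambda>i j. a i j powr \<alpha>) (\<lambda>i. v i + t * 1)
        = qform I (\<lambda>i j. a i j powr \<alpha>) (\<lambda>i. v i + t * 1)"
      using fin VI off by (intro qform_mono_neutral[symmetric]) auto
    finally have "qform I (\<lambda>i j. a i j powr \<alpha>) (\<lambda>i. v i + t * 1) \<le> 0"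
      using s by (simp add: mult_le_0_iff)
    moreover have "qform I (\<lambda>i j. a i j powr \<alpha>) (\<lambda>i. v i + t * 1)
        = qform I (\<lambda>i j. a i j powr \<alpha>) v
          + 2 * t * (\<Sum>i\<in>I. 1 * (\<Sum>j\<in>I. a i j powr \<alpha> * v j))
          + t\<^sup>2 * qform I (\<lambda>i j. a i j powr \<alpha>) (\<lambda>_. 1)"
      by (rule qform_add) (simp add: sym)
    moreover have "(\<Sum>i\<in>I. 1 * (\<Sum>j\<in>I. a i j powr \<alpha> * v j)) = 0"
      using sum_weighted_row_sums[of I "\<lambda>i j. a i j powr \<alpha>" v] sym v by simp
    moreover have "0 \<le> qform I (\<lambda>i j. a i j powr \<alpha>) (\<lambda>_. 1)"
      unfolding qform_def by (intro sum_nonneg) auto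
    ultimately have "qform I (\<lambda>i j. a i j powr \<alpha>) v \<le> - (t\<^sup>2 * qform I (\<lambda>i j. a i j powr \<alpha>) (\<lambda>_. 1))"
      and "0 \<le> t\<^sup>2 * qform I (\<lambda>i j. a i j powr \<alpha>) (\<lambda>_. 1)"
      by simp_all
    then show ?thesis by linarith
  qed
qed

section \<open>Largest eigenvalue on a hyperplane\<close>

lemma rayleigh_maximizer:
  fixes g v0 :: "'a \<Rightarrow> real" and h :: "'a \<Rightarrow> 'a \<Rightarrow> real"
  assumes fin: "finite I" and gpos: "\<And>i. i \<in> I \<Longrightarrow> 0 < g i"
    and sym: "\<And>i j. i \<in> I \<Longrightarrow> j \<in> I \<Longrightarrow> h i j = h j i"
    and rows: "\<And>i. i \<in> I \<Longrightarrow> (\<Sum>j\<in>I. h i j) = m * g i"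
    and v0: "(\<Sum>i\<in>I. g i * v0 i) = 0" "0 < qform I h v0"
  obtains v \<mu> where "0 < \<mu>" "(\<Sum>i\<in>I. g i * v i) = 0" "(\<Sum>i\<in>I. g i * (v i)\<^sup>2) = 1"
    "\<And>i. i \<in> I \<Longrightarrow> (\<Sum>j\<in>I. h i j * v j) = \<mu> * g i * v i"
proof -
  define X where "X i = (if i \<in> I then {- 1 / sqrt (g i)..1 / sqrt (g i)} else {0})" for i
  define K where "K = {v. (\<Sum>i\<in>I. g i * v i) = 0} \<inter> {v. (\<Sum>i\<in>I. g i * (v i)\<^sup>2) = 1} \<inter> PiE UNIV X"
  have coord: "continuous_on UNIV (\<lambda>v. v i :: real)" for i :: 'a
    by (rule continuous_on_product_coordinates)
  have "compactin (product_topology (\<lambda>_. euclidean) UNIV) (PiE UNIV X)"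
    unfolding compactin_PiE by (auto simp: X_def)
  then have cX: "compact (PiE UNIV X)" by (simp add: euclidean_product_topology)
  have "closed {v. (\<Sum>i\<in>I. g i * v i) = 0}" "closed {v. (\<Sum>i\<in>I. g i * (v i)\<^sup>2) = 1}"
    by (intro closed_Collect_eq continuous_on_sum continuous_on_mult continuous_on_power
        continuous_on_const coord)+
  then have "compact K" unfolding K_def by (intro closed_Int_compact closed_Int cX)
  have K_iff: "v \<in> K \<longleftrightarrow> (\<Sum>i\<in>I. g i * v i) = 0 \<and> (\<Sum>i\<in>I. g i * (v i)\<^sup>2) = 1 \<and> (\<forall>i. i \<notin> I \<longrightarrow> v i = 0)"
    for v
  proof -
    have "v i \<in> X i" if "(\<Sum>i\<in>I. g i * (v i)\<^sup>2) = 1" "i \<in> I" for i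
    proof -
      have "g i * (v i)\<^sup>2 \<le> (\<Sum>i\<in>I. g i * (v i)\<^sup>2)"
        using that fin gpos by (intro member_le_sum) (auto simp: less_imp_le)
      then have "(sqrt (g i) * v i)\<^sup>2 \<le> 1"
        using that gpos[of i] by (simp add: power_mult_distrib)
      then have "\<bar>sqrt (g i) * v i\<bar> \<le> 1" by (simp add: abs_square_le_1)
      then show ?thesis
        using that gpos[of i] by (auto simp: X_def field_simps abs_le_iff)
    qed
    moreover have "v i \<in> X i" if "i \<notin> I" "v i = 0" for i using that by (simp add: X_def)
    moreover have "v i = 0" if "i \<notin> I" "v i \<in> X i" for i using that by (simp add: X_def)
    ultimately show ?thesis unfolding K_def PiE_UNIV_domain Pi_iff by blast
  qed
  have normsq0: "x i = 0" if "(\<Sum>i\<in>I. g i * (x i)\<^sup>2) \<le> 0" "i \<in> I" for x i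
  proof -
    have "0 \<le> (\<Sum>i\<in>I. g i * (x i)\<^sup>2)" using gpos by (intro sum_nonneg) (simp add: less_imp_le)
    with that have "(\<Sum>i\<in>I. g i * (x i)\<^sup>2) = 0" by simp
    then have "g i * (x i)\<^sup>2 = 0"
      using gpos fin that by (subst (asm) sum_nonneg_eq_0_iff) (auto simp: less_imp_le)
    then show ?thesis using gpos[of i] that by simp
  qed
  have normalise: "\<exists>x'\<in>K. qform I h x = (\<Sum>i\<in>I. g i * (x i)\<^sup>2) * qform I h x'"
    if x: "(\<Sum>i\<in>I. g i * x i) = 0" "0 < (\<Sum>i\<in>I. g i * (x i)\<^sup>2)" for x
  proof -
    define r where "r = (\<Sum>i\<in>I. g i * (x i)\<^sup>2)"
    define x' where "x' i = (if i \<in> I then x i / sqrt r else 0)" for i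
    have r: "r > 0" using x by (simp add: r_def)
    have "(\<Sum>i\<in>I. g i * x' i) = (\<Sum>i\<in>I. g i * x i) / sqrt r"
      unfolding sum_divide_distrib by (intro sum.cong) (auto simp: x'_def)
    moreover have "(\<Sum>i\<in>I. g i * (x' i)\<^sup>2) = r / r"
      unfolding r_def sum_divide_distrib
      by (intro sum.cong) (use r in \<open>auto simp: x'_def power_divide r_def\<close>)
    ultimately have "x' \<in> K" using x r by (simp add: K_iff x'_def)
    moreover have "qform I h x = r * qform I h x'"
      unfolding qform_cmult[symmetric]
      by (intro qform_cong) (use r in \<open>auto simp: x'_def field_simps\<close>)
    ultimately show ?thesis by (auto simp: r_def)
  qed
  have "0 < (\<Sum>i\<in>I. g i * (v0 i)\<^sup>2)"
  proof (rule ccontr)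
    assume "\<not> ?thesis"
    then have "v0 i = 0" if "i \<in> I" for i using normsq0[of v0 i] that by simp
    then have "qform I h v0 = 0" unfolding qform_def by simp
    with v0 show False by simp
  qed
  then obtain v1 where v1: "v1 \<in> K" "qform I h v0 = (\<Sum>i\<in>I. g i * (v0 i)\<^sup>2) * qform I h v1"
    using normalise[OF v0(1)] by blast
  have v1': "qform I h v1 > 0"
    using v0(2) \<open>0 < (\<Sum>i\<in>I. g i * (v0 i)\<^sup>2)\<close> unfolding v1(2) by (rule zero_less_mult_pos)
  have "continuous_on K (qform I h)"
    unfolding qform_def
    by (intro continuous_on_sum continuous_on_mult continuous_on_const
        continuous_on_subset[OF coord] subset_UNIV)
  then obtain v where v: "v \<in> K" "\<And>x. x \<in> K \<Longrightarrow> qform I h x \<le> qform I h v"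
    using continuous_attains_sup[OF \<open>compact K\<close>] v1 by blast
  define \<mu> where "\<mu> = qform I h v"
  have \<mu>: "\<mu> > 0" using v(2)[OF v1(1)] v1' by (simp add: \<mu>_def)
  have gv: "(\<Sum>i\<in>I. g i * v i) = 0" "(\<Sum>i\<in>I. g i * (v i)\<^sup>2) = 1" using v(1) by (auto simp: K_iff)
  have le: "qform I h x \<le> \<mu> * (\<Sum>i\<in>I. g i * (x i)\<^sup>2)" if x: "(\<Sum>i\<in>I. g i * x i) = 0" for x
  proof (cases "0 < (\<Sum>i\<in>I. g i * (x i)\<^sup>2)")
    case True
    obtain x' where "x' \<in> K" "qform I h x = (\<Sum>i\<in>I. g i * (x i)\<^sup>2) * qform I h x'"
      using normalise[OF x True] by blast
    then show ?thesis
      using v(2) True by (simp add: \<mu>_def mult.commute[of "qform I h v"] mult_left_mono)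
  next
    case False
    then have "x i = 0" if "i \<in> I" for i using normsq0[of x i] that by simp
    then show ?thesis by (simp add: qform_def)
  qed
  define y where "y i = (\<Sum>j\<in>I. h i j * v j)" for i
  \<comment> \<open>The residual is an admissible direction, and the derivative of the Rayleigh quotient along it is
    a positive multiple of its squared norm; hence it vanishes at the maximum.\<close>
  define w where "w i = y i / g i - \<mu> * v i" for i
  have wy: "g i * w i = y i - \<mu> * (g i * v i)" if "i \<in> I" for i
    using gpos[OF that] by (simp add: w_def field_simps)
  have "(\<Sum>i\<in>I. y i) = (\<Sum>i\<in>I. v i * (m * g i))"
    unfolding y_def using sum_weighted_row_sums[of I h v] sym rows by simp
  also have "\<dots> = m * (\<Sum>i\<in>I. g i * v i)" by (simp add: sum_distrib_left mult_ac)
  finally have "(\<Sum>i\<in>I. y i) = 0" using gv by simp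
  then have gw: "(\<Sum>i\<in>I. g i * w i) = 0"
    using gv by (simp add: wy sum_subtractf sum_distrib_left[symmetric] cong: sum.cong)
  define W where "W = (\<Sum>i\<in>I. g i * (w i)\<^sup>2)"
  have "(\<Sum>i\<in>I. w i * y i) - \<mu> * (\<Sum>i\<in>I. g i * v i * w i) = (\<Sum>i\<in>I. w i * (g i * w i))"
    unfolding sum_distrib_left sum_subtractf[symmetric]
    by (intro sum.cong) (auto simp: wy algebra_simps)
  also have "\<dots> = W" by (simp add: W_def power2_eq_square mult_ac)
  finally have W: "(\<Sum>i\<in>I. w i * y i) - \<mu> * (\<Sum>i\<in>I. g i * v i * w i) = W" .
  have "0 \<le> (\<mu> * W - qform I h w) * t\<^sup>2 + 2 * (- W) * t + 0" for t
  proof -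
    have "(\<Sum>i\<in>I. g i * (v i + t * w i)) = (\<Sum>i\<in>I. g i * v i) + t * (\<Sum>i\<in>I. g i * w i)"
      by (simp add: sum_distrib_left sum.distrib[symmetric] algebra_simps)
    also have "\<dots> = 0" using gv gw by simp
    finally have "qform I h (\<lambda>i. v i + t * w i) \<le> \<mu> * (\<Sum>i\<in>I. g i * (v i + t * w i)\<^sup>2)"
      by (rule le)
    moreover have "(\<Sum>i\<in>I. g i * (v i + t * w i)\<^sup>2)
        = (\<Sum>i\<in>I. g i * (v i)\<^sup>2) + 2 * t * (\<Sum>i\<in>I. g i * v i * w i) + t\<^sup>2 * W"
      unfolding W_def
      by (simp add: sum_distrib_left sum.distrib[symmetric] power2_eq_square algebra_simps)
    moreover have "qform I h (\<lambda>i. v i + t * w i)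
        = \<mu> + 2 * t * (\<Sum>i\<in>I. w i * y i) + t\<^sup>2 * qform I h w"
      unfolding \<mu>_def y_def by (rule qform_add) (rule sym)
    ultimately have "0 \<le> (\<mu> * W - qform I h w) * t\<^sup>2
        - 2 * ((\<Sum>i\<in>I. w i * y i) - \<mu> * (\<Sum>i\<in>I. g i * v i * w i)) * t"
      using gv by (simp add: algebra_simps)
    then show ?thesis unfolding W by simp
  qed
  then have "(- W)\<^sup>2 \<le> (\<mu> * W - qform I h w) * 0"
    using le[OF gw] by (intro quadratic_nonneg_discriminant) (auto simp: W_def)
  then have "W = 0" by simp
  then have "w i = 0" if "i \<in> I" for i using normsq0[of w i] that by (simp add: W_def)
  then have "y i = \<mu> * g i * v i" if "i \<in> I" for i using wy[of i] that by simp
  then show thesis using that[OF \<mu> gv] unfolding y_def by blast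
qed

lemma qform_nonpos_if_spectral_gap:
  fixes g v0 :: "'a \<Rightarrow> real" and h :: "'a \<Rightarrow> 'a \<Rightarrow> real"
  assumes fin: "finite I" and g0: "\<And>i. i \<in> I \<Longrightarrow> 0 \<le> g i"
    and sym: "\<And>i j. i \<in> I \<Longrightarrow> j \<in> I \<Longrightarrow> h i j = h j i"
    and h0: "\<And>i j. i \<in> I \<Longrightarrow> j \<in> I \<Longrightarrow> 0 \<le> h i j"
    and rows: "\<And>i. i \<in> I \<Longrightarrow> (\<Sum>j\<in>I. h i j) = m * g i"
    and conn: "\<And>X. X \<subset> {i\<in>I. 0 < g i} \<Longrightarrow> X \<noteq> {} \<Longrightarrow> \<exists>i\<in>X. \<exists>j\<in>{i\<in>I. 0 < g i} - X. 0 < h i j"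
    and gap: "\<And>v \<mu>. 0 < \<mu> \<Longrightarrow> (\<And>i. i \<in> I \<Longrightarrow> (\<Sum>j\<in>I. h i j * v j) = \<mu> * g i * v i) \<Longrightarrow>
      (\<Sum>i\<in>I. g i * (v i)\<^sup>2) = 1 \<Longrightarrow> m \<le> \<mu>"
    and v0: "(\<Sum>i\<in>I. g i * v0 i) = 0"
  shows "qform I h v0 \<le> 0"
proof (rule ccontr)
  assume neg: "\<not> ?thesis"
  define V where "V = {i\<in>I. 0 < g i}"
  have V: "V \<subseteq> I" "finite V" using fin by (auto simp: V_def)
  have gz: "g i = 0" if "i \<in> I" "i \<notin> V" for i using g0[of i] that by (force simp: V_def)
  have off: "h i j = 0" if "i \<in> I" "j \<in> I" "i \<notin> V \<or> j \<notin> V" for i j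
  proof -
    have *: "h i j = 0" if "i \<in> I" "j \<in> I" "i \<notin> V" for i j
    proof -
      have "(\<Sum>j\<in>I. h i j) = 0" using rows gz that by simp
      then show ?thesis using h0 that fin by (subst (asm) sum_nonneg_eq_0_iff) auto
    qed
    then show ?thesis using that sym by metis
  qed
  have gV: "(\<Sum>i\<in>I. g i * f i) = (\<Sum>i\<in>V. g i * f i)" for f
    using gz V fin by (intro sum.mono_neutral_right) auto
  have hV: "(\<Sum>j\<in>I. h i j * f j) = (\<Sum>j\<in>V. h i j * f j)" if "i \<in> I" for i f
    using off V fin that by (intro sum.mono_neutral_right) auto
  have rowsV: "(\<Sum>j\<in>V. h i j) = m * g i" if "i \<in> V" for i
    using rows[of i] hV[of i "\<lambda>_. 1"] V that by auto
  have "qform I h v0 = qform V h v0" using fin V off by (intro qform_mono_neutral) auto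
  with neg have q: "0 < qform V h v0" by simp
  have gposV: "0 < g i" if "i \<in> V" for i using that by (simp add: V_def)
  have symV: "h i j = h j i" if "i \<in> V" "j \<in> V" for i j using that V sym by blast
  obtain v \<mu> where v: "0 < \<mu>" "(\<Sum>i\<in>V. g i * v i) = 0" "(\<Sum>i\<in>V. g i * (v i)\<^sup>2) = 1"
    "\<And>i. i \<in> V \<Longrightarrow> (\<Sum>j\<in>V. h i j * v j) = \<mu> * g i * v i"
    using rayleigh_maximizer[OF V(2) gposV symV rowsV v0[unfolded gV] q] by blast
  have "m \<le> \<mu>"
  proof (rule gap[OF v(1)])
    show "(\<Sum>j\<in>I. h i j * v j) = \<mu> * g i * v i" if "i \<in> I" for i
      using v(4) hV[OF that] gz[OF that] off that V by (cases "i \<in> V") auto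
    show "(\<Sum>i\<in>I. g i * (v i)\<^sup>2) = 1" unfolding gV by (rule v(3))
  qed
  have "qform V h v = (\<Sum>i\<in>V. \<mu> * (g i * (v i)\<^sup>2))"
    unfolding qform_alt using v(4) by (intro sum.cong) (auto simp: power2_eq_square)
  then have Q: "qform V h v = \<mu>" using v(3) by (simp add: sum_distrib_left[symmetric])
  have r1: "(\<Sum>i\<in>V. \<Sum>j\<in>V. h i j * (v i)\<^sup>2) = m"
  proof -
    have "(\<Sum>i\<in>V. \<Sum>j\<in>V. h i j * (v i)\<^sup>2) = (\<Sum>i\<in>V. m * (g i * (v i)\<^sup>2))"
      using rowsV by (intro sum.cong) (auto simp: sum_distrib_right[symmetric])
    then show ?thesis using v(3) by (simp add: sum_distrib_left[symmetric])
  qed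
  have r2: "(\<Sum>i\<in>V. \<Sum>j\<in>V. h i j * (v j)\<^sup>2) = m"
    using V by (subst r1[symmetric], subst sum.swap) (intro sum.cong refl, auto simp: sym subset_iff)
  have "(\<Sum>i\<in>V. \<Sum>j\<in>V. h i j * (v i - v j)\<^sup>2)
      = (\<Sum>i\<in>V. \<Sum>j\<in>V. h i j * (v i)\<^sup>2) + (\<Sum>i\<in>V. \<Sum>j\<in>V. h i j * (v j)\<^sup>2) - 2 * qform V h v"
    unfolding qform_def
    by (simp add: sum_distrib_left sum.distrib[symmetric] sum_subtractf[symmetric]
        power2_eq_square algebra_simps)
  then have "(\<Sum>i\<in>V. \<Sum>j\<in>V. h i j * (v i - v j)\<^sup>2) \<le> 0"
    using r1 r2 Q \<open>m \<le> \<mu>\<close> by simp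
  moreover have nnt: "0 \<le> h i j * (v i - v j)\<^sup>2" if "i \<in> V" "j \<in> V" for i j
    using h0 V that by (intro mult_nonneg_nonneg) auto
  then have nn: "0 \<le> (\<Sum>j\<in>V. h i j * (v i - v j)\<^sup>2)" if "i \<in> V" for i
    using that by (intro sum_nonneg) auto
  ultimately have "(\<Sum>i\<in>V. \<Sum>j\<in>V. h i j * (v i - v j)\<^sup>2) = 0"
    by (meson order_antisym sum_nonneg)
  then have z': "(\<Sum>j\<in>V. h i j * (v i - v j)\<^sup>2) = 0" if "i \<in> V" for i
    using nn V that by (subst (asm) sum_nonneg_eq_0_iff) auto
  have z: "h i j * (v i - v j)\<^sup>2 = 0" if "i \<in> V" "j \<in> V" for i j
    using z'[OF that(1)] nnt[OF that(1)] V that(2) by (subst (asm) sum_nonneg_eq_0_iff) auto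
  obtain a where a: "a \<in> V" using v(3) by fastforce
  have const: "v i = v a" if "i \<in> V" for i
  proof (rule ccontr)
    assume "v i \<noteq> v a"
    then have "{i\<in>V. v i = v a} \<subset> V" using that by auto
    then obtain b c where "b \<in> V" "v b = v a" "c \<in> V" "v c \<noteq> v a" "h b c > 0"
      using conn[of "{i\<in>V. v i = v a}"] a unfolding V_def[symmetric] by auto
    then show False using z[of b c] by auto
  qed
  have "sum g V > 0" using a V by (intro sum_pos) (auto simp: V_def)
  moreover have "(\<Sum>i\<in>V. g i * v i) = sum g V * v a"
    unfolding sum_distrib_right using const by (intro sum.cong) auto
  ultimately have "v a = 0" using v(2) by simp
  then show False using v(3) const by simp
qed

section \<open>Homogeneous multiaffine polynomials at the all-ones point\<close>

definition coeff_deriv :: "nat \<Rightarrow> (nat set \<Rightarrow> real) \<Rightarrow> nat set \<Rightarrow> real" where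
  "coeff_deriv i c S = (if i \<in> S then 0 else c (insert i S))"

definition coeff_sum :: "nat \<Rightarrow> (nat set \<Rightarrow> real) \<Rightarrow> real" where
  "coeff_sum n c = (\<Sum>S\<in>Pow {1..n}. c S)"

definition grad_one :: "nat \<Rightarrow> (nat set \<Rightarrow> real) \<Rightarrow> nat \<Rightarrow> real" where
  "grad_one n c i = coeff_sum n (coeff_deriv i c)"

definition hess_one :: "nat \<Rightarrow> (nat set \<Rightarrow> real) \<Rightarrow> nat \<Rightarrow> nat \<Rightarrow> real" where
  "hess_one n c i j = coeff_sum n (coeff_deriv i (coeff_deriv j c))"

definition hess_nsd_on_grad_perp :: "nat \<Rightarrow> (nat set \<Rightarrow> real) \<Rightarrow> bool" where
  "hess_nsd_on_grad_perp n c \<longleftrightarrow>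
     (\<forall>v. (\<Sum>i=1..n. grad_one n c i * v i) = 0 \<longrightarrow> qform {1..n} (hess_one n c) v \<le> 0)"

definition nonneg_coeffs :: "nat \<Rightarrow> (nat set \<Rightarrow> real) \<Rightarrow> bool" where
  "nonneg_coeffs n c \<longleftrightarrow> (\<forall>S\<subseteq>{1..n}. 0 \<le> c S)"

definition homogeneous_coeffs :: "nat \<Rightarrow> nat \<Rightarrow> (nat set \<Rightarrow> real) \<Rightarrow> bool" where
  "homogeneous_coeffs n k c \<longleftrightarrow> (\<forall>S\<subseteq>{1..n}. c S \<noteq> 0 \<longrightarrow> card S = k)"

lemma coeff_deriv_commute: "coeff_deriv i (coeff_deriv j c) = coeff_deriv j (coeff_deriv i c)"
  by (auto simp: coeff_deriv_def fun_eq_iff insert_commute)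

lemma coeff_deriv_powr:
  "coeff_deriv i (\<lambda>S. c S powr \<alpha>) = (\<lambda>S. coeff_deriv i c S powr \<alpha>)"
  by (auto simp: coeff_deriv_def fun_eq_iff)

lemma nonneg_coeff_deriv:
  "nonneg_coeffs n c \<Longrightarrow> i \<in> {1..n} \<Longrightarrow> nonneg_coeffs n (coeff_deriv i c)"
  by (auto simp: nonneg_coeffs_def coeff_deriv_def)

lemma homogeneous_coeff_deriv:
  assumes "homogeneous_coeffs n k c" "i \<in> {1..n}"
  shows "homogeneous_coeffs n (k - 1) (coeff_deriv i c)"
  unfolding homogeneous_coeffs_def
proof (intro allI impI)
  fix S assume S: "S \<subseteq> {1..n}" "coeff_deriv i c S \<noteq> 0"
  then have "i \<notin> S" "c (insert i S) \<noteq> 0" by (auto simp: coeff_deriv_def split: if_splits)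
  moreover have "insert i S \<subseteq> {1..n}" using S assms by auto
  ultimately have "card (insert i S) = k" using assms unfolding homogeneous_coeffs_def by blast
  moreover have "finite S" using S finite_subset by blast
  ultimately show "card S = k - 1" using \<open>i \<notin> S\<close> by simp
qed

lemma sum_Pow_split:
  fixes F :: "'a set \<Rightarrow> real"
  assumes "finite I" "i \<in> I"
  shows "(\<Sum>S\<in>Pow I. F S) = (\<Sum>S\<in>Pow (I - {i}). F S) + (\<Sum>S\<in>Pow (I - {i}). F (insert i S))"
proof -
  have "Pow I = Pow (I - {i}) \<union> insert i ` Pow (I - {i})"
    using Pow_insert[of i "I - {i}"] assms by (simp add: insert_absorb)
  also have "sum F \<dots> = (\<Sum>S\<in>Pow (I - {i}). F S) + (\<Sum>S\<in>insert i ` Pow (I - {i}). F S)"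
    using assms by (intro sum.union_disjoint) auto
  also have "(\<Sum>S\<in>insert i ` Pow (I - {i}). F S) = (\<Sum>S\<in>Pow (I - {i}). F (insert i S))"
  proof -
    have "inj_on (insert i) (Pow (I - {i}))"
      by (rule inj_onI) (metis Diff_insert_absorb PowD insert_Diff_single subset_Diff_insert)
    then show ?thesis by (simp add: sum.reindex)
  qed
  finally show ?thesis .
qed

lemma coeff_sum_deriv:
  assumes "i \<in> {1..n}"
  shows "coeff_sum n (coeff_deriv i c) = (\<Sum>S\<in>Pow {1..n}. if i \<in> S then c S else 0)"
proof -
  have "coeff_sum n (coeff_deriv i c) = (\<Sum>S\<in>Pow ({1..n} - {i}). c (insert i S))"
    unfolding coeff_sum_def using assms
    by (subst sum_Pow_split[of _ i]) (auto simp: coeff_deriv_def intro!: sum.cong)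
  also have "\<dots> = (\<Sum>S\<in>Pow {1..n}. if i \<in> S then c S else 0)"
    using assms by (subst sum_Pow_split[of _ i]) (auto intro!: sum.neutral)
  finally show ?thesis .
qed

lemma coeff_sum_nonneg: "nonneg_coeffs n c \<Longrightarrow> 0 \<le> coeff_sum n c"
  by (auto simp: coeff_sum_def nonneg_coeffs_def intro!: sum_nonneg)

lemma grad_one_nonneg: "nonneg_coeffs n c \<Longrightarrow> i \<in> {1..n} \<Longrightarrow> 0 \<le> grad_one n c i"
  by (simp add: grad_one_def coeff_sum_nonneg nonneg_coeff_deriv)

lemma hess_one_nonneg:
  "nonneg_coeffs n c \<Longrightarrow> i \<in> {1..n} \<Longrightarrow> j \<in> {1..n} \<Longrightarrow> 0 \<le> hess_one n c i j"
  by (simp add: hess_one_def coeff_sum_nonneg nonneg_coeff_deriv)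

lemma hess_one_sym: "hess_one n c i j = hess_one n c j i"
  by (simp add: hess_one_def coeff_deriv_commute)

lemma hess_one_eq_grad: "hess_one n c i j = grad_one n (coeff_deriv j c) i"
  by (simp add: hess_one_def grad_one_def)

lemma hess_one_eq_grad': "hess_one n c i j = grad_one n (coeff_deriv i c) j"
  by (metis hess_one_sym hess_one_eq_grad)

lemma grad_one_eq_0:
  assumes "nonneg_coeffs n c" "coeff_sum n c = 0" "i \<in> {1..n}"
  shows "grad_one n c i = 0"
proof -
  have "grad_one n c i \<le> coeff_sum n c"
    unfolding grad_one_def coeff_sum_deriv[OF assms(3)] unfolding coeff_sum_def
    using assms by (intro sum_mono) (auto simp: nonneg_coeffs_def)
  then show ?thesis using grad_one_nonneg[OF assms(1,3)] assms(2) by simp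
qed

lemma hess_one_eq_0:
  assumes "nonneg_coeffs n c" "coeff_sum n c = 0" "i \<in> {1..n}" "j \<in> {1..n}"
  shows "hess_one n c i j = 0"
  unfolding hess_one_eq_grad using assms grad_one_eq_0[OF assms(1,2), of j]
  by (intro grad_one_eq_0 nonneg_coeff_deriv) (auto simp: grad_one_def)

lemma sum_grad_one:
  assumes "homogeneous_coeffs n k c"
  shows "(\<Sum>i=1..n. grad_one n c i) = real k * coeff_sum n c"
proof -
  have "(\<Sum>i=1..n. grad_one n c i) = (\<Sum>i=1..n. \<Sum>S\<in>Pow {1..n}. if i \<in> S then c S else 0)"
    unfolding grad_one_def by (intro sum.cong refl coeff_sum_deriv)
  also have "\<dots> = (\<Sum>S\<in>Pow {1..n}. \<Sum>i=1..n. if i \<in> S then c S else 0)"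
    by (rule sum.swap)
  also have "\<dots> = (\<Sum>S\<in>Pow {1..n}. real k * c S)"
  proof (intro sum.cong refl)
    fix S assume S: "S \<in> Pow {1..n}"
    then have "(\<Sum>i=1..n. if i \<in> S then c S else 0) = (\<Sum>i\<in>S. c S)"
      by (simp add: sum.inter_restrict[symmetric] Int_absorb1)
    also have "\<dots> = real k * c S"
      using assms S by (cases "c S = 0") (auto simp: homogeneous_coeffs_def)
    finally show "(\<Sum>i=1..n. if i \<in> S then c S else 0) = real k * c S" .
  qed
  finally show ?thesis by (simp add: coeff_sum_def sum_distrib_left)
qed

lemma sum_hess_one:
  assumes "homogeneous_coeffs n k c" "i \<in> {1..n}"
  shows "(\<Sum>j=1..n. hess_one n c i j) = real (k - 1) * grad_one n c i"
  unfolding hess_one_eq_grad' sum_grad_one[OF homogeneous_coeff_deriv[OF assms]]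
  by (simp only: grad_one_def)

lemma hess_nsd_bound:
  assumes nsd: "hess_nsd_on_grad_perp n c" and nonneg: "nonneg_coeffs n c"
    and hom: "homogeneous_coeffs n k c" and k: "1 \<le> k"
  shows "real k * coeff_sum n c * qform {1..n} (hess_one n c) v
    \<le> (real k - 1) * (\<Sum>i=1..n. grad_one n c i * v i)\<^sup>2"
proof (cases "coeff_sum n c = 0")
  case True
  then show ?thesis using k by simp
next
  case False
  define p where "p = coeff_sum n c"
  have p: "p > 0" using False coeff_sum_nonneg[OF nonneg] by (simp add: p_def)
  define \<gamma> where "\<gamma> = (\<Sum>i=1..n. grad_one n c i * v i)"
  define t where "t = - \<gamma> / (real k * p)"
  have tk: "t * (real k * p) = - \<gamma>" using p k by (simp add: t_def)
  have "(\<Sum>i=1..n. grad_one n c i * (v i + t * 1)) = \<gamma> + t * (\<Sum>i=1..n. grad_one n c i)"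
    unfolding \<gamma>_def sum_distrib_left sum.distrib[symmetric] by (simp add: algebra_simps)
  also have "\<dots> = 0" unfolding sum_grad_one[OF hom] p_def[symmetric] tk by simp
  finally have "qform {1..n} (hess_one n c) (\<lambda>i. v i + t * 1) \<le> 0"
    by (rule nsd[unfolded hess_nsd_on_grad_perp_def, rule_format])
  moreover have "qform {1..n} (hess_one n c) (\<lambda>i. v i + t * 1)
      = qform {1..n} (hess_one n c) v
        + 2 * t * (\<Sum>i=1..n. 1 * (\<Sum>j=1..n. hess_one n c i j * v j))
        + t\<^sup>2 * qform {1..n} (hess_one n c) (\<lambda>_. 1)"
    by (rule qform_add) (rule hess_one_sym)
  moreover have "(\<Sum>i=1..n. 1 * (\<Sum>j=1..n. hess_one n c i j * v j)) = (real k - 1) * \<gamma>"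
  proof -
    have "(\<Sum>i=1..n. 1 * (\<Sum>j=1..n. hess_one n c i j * v j))
        = (\<Sum>i=1..n. v i * (\<Sum>j=1..n. hess_one n c i j))"
      using sum_weighted_row_sums[of "{1..n}" "hess_one n c" v] hess_one_sym by simp
    also have "\<dots> = (\<Sum>i=1..n. (real k - 1) * (grad_one n c i * v i))"
      using k by (intro sum.cong refl) (simp add: sum_hess_one[OF hom] of_nat_diff del: One_nat_def)
    finally show ?thesis by (simp add: \<gamma>_def sum_distrib_left)
  qed
  moreover have "qform {1..n} (hess_one n c) (\<lambda>_. 1) = (real k - 1) * (real k * p)"
  proof -
    have "qform {1..n} (hess_one n c) (\<lambda>_. 1) = (\<Sum>i=1..n. (real k - 1) * grad_one n c i)"
      unfolding qform_def using k
      by (intro sum.cong refl) (simp add: sum_hess_one[OF hom] of_nat_diff del: One_nat_def)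
    then show ?thesis
      by (simp add: sum_distrib_left[symmetric] sum_grad_one[OF hom] p_def del: One_nat_def)
  qed
  ultimately have "qform {1..n} (hess_one n c) v
      + 2 * t * ((real k - 1) * \<gamma>) + t\<^sup>2 * ((real k - 1) * (real k * p)) \<le> 0"
    by simp
  also have "t\<^sup>2 * ((real k - 1) * (real k * p)) = - t * (real k - 1) * \<gamma>"
  proof -
    have "t\<^sup>2 * ((real k - 1) * (real k * p)) = t * (real k - 1) * (t * (real k * p))"
      by (simp add: power2_eq_square mult_ac)
    then show ?thesis unfolding tk by simp
  qed
  finally have "qform {1..n} (hess_one n c) v \<le> - (t * (real k - 1) * \<gamma>)"
    by (simp add: algebra_simps)
  then have "(real k * p) * qform {1..n} (hess_one n c) v
      \<le> (real k * p) * - (t * (real k - 1) * \<gamma>)"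
    using p k by (intro mult_left_mono) auto
  also have "\<dots> = - (t * (real k * p)) * ((real k - 1) * \<gamma>)" by (simp add: mult_ac)
  also have "\<dots> = (real k - 1) * \<gamma>\<^sup>2" unfolding tk by (simp add: power2_eq_square mult_ac)
  finally show ?thesis by (simp add: p_def \<gamma>_def)
qed

lemma hess_one_connected:
  assumes nsd: "hess_nsd_on_grad_perp n c" and nonneg: "nonneg_coeffs n c"
    and hom: "homogeneous_coeffs n k c" and k: "2 \<le> k"
    and X: "X \<subset> {i\<in>{1..n}. 0 < grad_one n c i}" "X \<noteq> {}"
  shows "\<exists>i\<in>X. \<exists>j\<in>{i\<in>{1..n}. 0 < grad_one n c i} - X. 0 < hess_one n c i j"
proof (rule ccontr)
  assume none: "\<not> ?thesis"
  define Y where "Y = {i\<in>{1..n}. 0 < grad_one n c i} - X"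
  have Xn: "X \<subseteq> {1..n}" and Yn: "Y \<subseteq> {1..n}" and "X \<inter> Y = {}" and "Y \<noteq> {}"
    using X by (auto simp: Y_def)
  have fin: "finite X" "finite Y" using Xn Yn finite_subset by blast+
  have XY: "hess_one n c i j = 0" if "i \<in> X" "j \<in> Y" for i j
    using none hess_one_nonneg[OF nonneg, of i j] that Xn Yn unfolding Y_def by force
  have gz: "grad_one n c i = 0" if "i \<in> {1..n}" "i \<notin> X" "i \<notin> Y" for i
    using grad_one_nonneg[OF nonneg, of i] that by (force simp: Y_def)
  have hz: "hess_one n c i j = 0" if "i \<in> {1..n}" "j \<in> {1..n}" "i \<notin> X" "i \<notin> Y" for i j
    using gz[of i] grad_one_eq_0[of n "coeff_deriv i c" j] nonneg_coeff_deriv[OF nonneg] that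
    by (simp add: hess_one_eq_grad' grad_one_def)
  define \<xi> where "\<xi> = (\<Sum>i\<in>X. grad_one n c i)"
  define \<beta> where "\<beta> = (\<Sum>i\<in>Y. grad_one n c i)"
  have pos: "\<xi> > 0" "\<beta> > 0"
    unfolding \<xi>_def \<beta>_def using X fin \<open>Y \<noteq> {}\<close> by (auto intro!: sum_pos simp: Y_def)
  define v where "v i = (if i \<in> X then \<beta> else - \<xi>)" for i
  have split: "(\<Sum>i=1..n. grad_one n c i * f i)
      = (\<Sum>i\<in>X. grad_one n c i * f i) + (\<Sum>i\<in>Y. grad_one n c i * f i)" for f
  proof -
    have "(\<Sum>i=1..n. grad_one n c i * f i) = (\<Sum>i\<in>X \<union> Y. grad_one n c i * f i)"
      using gz Xn Yn by (intro sum.mono_neutral_right) auto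
    then show ?thesis using fin \<open>X \<inter> Y = {}\<close> by (simp add: sum.union_disjoint)
  qed
  have sX: "(\<Sum>i\<in>X. grad_one n c i * f (v i)) = \<xi> * f \<beta>" for f
    unfolding \<xi>_def sum_distrib_right by (intro sum.cong) (auto simp: v_def)
  have sY: "(\<Sum>i\<in>Y. grad_one n c i * f (v i)) = \<beta> * f (- \<xi>)" for f
    unfolding \<beta>_def sum_distrib_right using \<open>X \<inter> Y = {}\<close> by (intro sum.cong) (auto simp: v_def)
  have "(\<Sum>i=1..n. grad_one n c i * v i) = 0"
    using sX[of "\<lambda>x. x"] sY[of "\<lambda>x. x"] unfolding split by simp
  then have "qform {1..n} (hess_one n c) v \<le> 0"
    by (rule nsd[unfolded hess_nsd_on_grad_perp_def, rule_format])
  moreover have "qform {1..n} (hess_one n c) v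
      = (\<Sum>i=1..n. (real k - 1) * (grad_one n c i * (v i)\<^sup>2))"
  proof (unfold qform_def, intro sum.cong refl)
    fix i assume i: "i \<in> {1..n}"
    have "hess_one n c i j * v j = hess_one n c i j * v i" if "j \<in> {1..n}" for j
      using hz[of i j] hz[of j i] XY[of i j] XY[of j i] i that
      by (auto simp: v_def hess_one_sym[of n c i j])
    then have "(\<Sum>j=1..n. v i * hess_one n c i j * v j) = (\<Sum>j=1..n. hess_one n c i j * (v i)\<^sup>2)"
      by (intro sum.cong refl) (simp add: power2_eq_square mult_ac)
    also have "\<dots> = (real k - 1) * (grad_one n c i * (v i)\<^sup>2)"
      using k by (simp add: sum_distrib_right[symmetric] sum_hess_one[OF hom i] of_nat_diff
          del: One_nat_def)
    finally show "(\<Sum>j=1..n. v i * hess_one n c i j * v j)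
        = (real k - 1) * (grad_one n c i * (v i)\<^sup>2)" .
  qed
  moreover have "(\<Sum>i=1..n. grad_one n c i * (v i)\<^sup>2) = \<xi> * \<beta>\<^sup>2 + \<beta> * (- \<xi>)\<^sup>2"
    using sX[of "\<lambda>x. x\<^sup>2"] sY[of "\<lambda>x. x\<^sup>2"] unfolding split by simp
  moreover have "(real k - 1) * (\<xi> * \<beta>\<^sup>2 + \<beta> * (- \<xi>)\<^sup>2) > 0"
    using k pos by (intro mult_pos_pos add_pos_pos) auto
  ultimately show False by (simp add: sum_distrib_left[symmetric])
qed

lemma sum_qform_hess_deriv:
  assumes "homogeneous_coeffs n k c"
  shows "(\<Sum>i=1..n. qform {1..n} (hess_one n (coeff_deriv i c)) v)
    = real (k - 2) * qform {1..n} (hess_one n c) v"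
proof -
  have e: "(\<Sum>i=1..n. hess_one n (coeff_deriv i c) a b) = real (k - 2) * hess_one n c a b"
    if "a \<in> {1..n}" "b \<in> {1..n}" for a b
  proof -
    have *: "hess_one n (coeff_deriv i c) a b = grad_one n (coeff_deriv a (coeff_deriv b c)) i" for i
      unfolding hess_one_def grad_one_def by (metis coeff_deriv_commute)
    have "homogeneous_coeffs n (k - 2) (coeff_deriv a (coeff_deriv b c))"
      using homogeneous_coeff_deriv[OF homogeneous_coeff_deriv[OF assms that(2)] that(1)]
      by (simp add: numeral_2_eq_2)
    then show ?thesis unfolding * by (simp only: sum_grad_one hess_one_def)
  qed
  have "(\<Sum>i=1..n. qform {1..n} (hess_one n (coeff_deriv i c)) v)
      = (\<Sum>a=1..n. \<Sum>i=1..n. \<Sum>b=1..n. v a * hess_one n (coeff_deriv i c) a b * v b)"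
    unfolding qform_def by (rule sum.swap)
  also have "\<dots> = (\<Sum>a=1..n. \<Sum>b=1..n. \<Sum>i=1..n. v a * hess_one n (coeff_deriv i c) a b * v b)"
    by (intro sum.cong refl sum.swap)
  also have "\<dots> = (\<Sum>a=1..n. \<Sum>b=1..n. v a * (real (k - 2) * hess_one n c a b) * v b)"
    by (intro sum.cong refl)
      (simp add: sum_distrib_left[symmetric] sum_distrib_right[symmetric] e del: One_nat_def)
  finally show ?thesis
    unfolding qform_cmult[symmetric] by (simp add: qform_def)
qed

lemma hess_nsd_trickle_down:
  assumes nonneg: "nonneg_coeffs n c" and hom: "homogeneous_coeffs n k c" and k: "3 \<le> k"
    and derivs: "\<And>i. i \<in> {1..n} \<Longrightarrow> hess_nsd_on_grad_perp n (coeff_deriv i c)"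
    and conn: "\<And>X. X \<subset> {i\<in>{1..n}. 0 < grad_one n c i} \<Longrightarrow> X \<noteq> {} \<Longrightarrow>
      \<exists>i\<in>X. \<exists>j\<in>{i\<in>{1..n}. 0 < grad_one n c i} - X. 0 < hess_one n c i j"
  shows "hess_nsd_on_grad_perp n c"
  unfolding hess_nsd_on_grad_perp_def
proof (intro allI impI)
  fix v0 assume v0: "(\<Sum>i=1..n. grad_one n c i * v0 i) = 0"
  show "qform {1..n} (hess_one n c) v0 \<le> 0"
  proof (rule qform_nonpos_if_spectral_gap[OF _ _ _ _ _ conn _ v0])
    show "(\<Sum>j=1..n. hess_one n c i j) = (real k - 1) * grad_one n c i" if "i \<in> {1..n}" for i
      using sum_hess_one[OF hom that] k by (simp add: of_nat_diff)
    fix v \<mu>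
    assume \<mu>: "0 < \<mu>" and ev: "\<And>i. i \<in> {1..n} \<Longrightarrow>
        (\<Sum>j=1..n. hess_one n c i j * v j) = \<mu> * grad_one n c i * v i"
      and norm: "(\<Sum>i=1..n. grad_one n c i * (v i)\<^sup>2) = 1"
    have "qform {1..n} (hess_one n c) v = (\<Sum>i=1..n. \<mu> * (grad_one n c i * (v i)\<^sup>2))"
      unfolding qform_alt using ev by (intro sum.cong refl) (simp add: power2_eq_square)
    then have Q: "qform {1..n} (hess_one n c) v = \<mu>"
      using norm by (simp add: sum_distrib_left[symmetric])
    have le: "(real k - 1) * qform {1..n} (hess_one n (coeff_deriv i c)) v
        \<le> (real k - 2) * \<mu>\<^sup>2 * (grad_one n c i * (v i)\<^sup>2)" if i: "i \<in> {1..n}" for i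
    proof (cases "grad_one n c i = 0")
      case True
      have "qform {1..n} (hess_one n (coeff_deriv i c)) v = 0"
        unfolding qform_def
        using hess_one_eq_0[OF nonneg_coeff_deriv[OF nonneg i]] True
        by (intro sum.neutral ballI) (simp add: grad_one_def)
      then show ?thesis using True by simp
    next
      case False
      define G where "G = grad_one n c i"
      have G: "G > 0" using False grad_one_nonneg[OF nonneg i] by (simp add: G_def)
      have "(\<Sum>j=1..n. grad_one n (coeff_deriv i c) j * v j) = \<mu> * G * v i"
        using ev[OF i] by (simp add: hess_one_eq_grad' G_def)
      then have "real (k - 1) * G * qform {1..n} (hess_one n (coeff_deriv i c)) v
          \<le> (real (k - 1) - 1) * (\<mu> * G * v i)\<^sup>2"
        using hess_nsd_bound[OF derivs[OF i] nonneg_coeff_deriv[OF nonneg i]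
            homogeneous_coeff_deriv[OF hom i], of v] k
        by (simp add: G_def grad_one_def)
      then have "G * ((real k - 1) * qform {1..n} (hess_one n (coeff_deriv i c)) v)
          \<le> G * ((real k - 2) * \<mu>\<^sup>2 * (G * (v i)\<^sup>2))"
        using k by (simp add: of_nat_diff power2_eq_square mult_ac)
      then show ?thesis using G unfolding G_def[symmetric] by (simp only: mult_le_cancel_left_pos)
    qed
    have "(real k - 1) * (\<Sum>i=1..n. qform {1..n} (hess_one n (coeff_deriv i c)) v)
        \<le> (real k - 2) * \<mu>\<^sup>2 * (\<Sum>i=1..n. grad_one n c i * (v i)\<^sup>2)"
      unfolding sum_distrib_left using le by (intro sum_mono) auto
    then have "((real k - 2) * \<mu>) * (real k - 1) \<le> ((real k - 2) * \<mu>) * \<mu>"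
      using k unfolding sum_qform_hess_deriv[OF hom] Q norm
      by (simp add: of_nat_diff power2_eq_square mult_ac)
    moreover have "(real k - 2) * \<mu> > 0" using k \<mu> by simp
    ultimately show "real k - 1 \<le> \<mu>" by (simp only: mult_le_cancel_left_pos)
  qed (auto simp: grad_one_nonneg[OF nonneg] hess_one_nonneg[OF nonneg] hess_one_sym)
qed

section \<open>Derivatives of multiaffine polynomials and of their logarithms\<close>

lemma multiaffine_poly_split:
  assumes "i \<in> {1..n}"
  shows "multiaffine_poly n c x = (\<Sum>S\<in>Pow ({1..n} - {i}). c S * (\<Prod>j\<in>S. x j))
    + x i * (\<Sum>S\<in>Pow ({1..n} - {i}). c (insert i S) * (\<Prod>j\<in>S. x j))"
proof -
  have "c (insert i S) * (\<Prod>j\<in>insert i S. x j) = x i * (c (insert i S) * (\<Prod>j\<in>S. x j))"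
    if "S \<in> Pow ({1..n} - {i})" for S
  proof -
    have "finite S" "i \<notin> S" using that finite_subset[of S "{1..n}"] by auto
    then show ?thesis by simp
  qed
  then show ?thesis
    unfolding multiaffine_poly_def sum_Pow_split[OF finite_atLeastAtMost assms] sum_distrib_left
    by (intro arg_cong2[of _ _ _ _ "(+)"] sum.cong refl)
qed

lemma multiaffine_poly_coeff_deriv:
  assumes "i \<in> {1..n}"
  shows "multiaffine_poly n (coeff_deriv i c) x
    = (\<Sum>S\<in>Pow ({1..n} - {i}). c (insert i S) * (\<Prod>j\<in>S. x j))"
proof -
  have "(\<Sum>S\<in>Pow ({1..n} - {i}). coeff_deriv i c (insert i S) * (\<Prod>j\<in>S. x j)) = 0"
    by (simp add: coeff_deriv_def)
  moreover have "(\<Sum>S\<in>Pow ({1..n} - {i}). coeff_deriv i c S * (\<Prod>j\<in>S. x j))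
      = (\<Sum>S\<in>Pow ({1..n} - {i}). c (insert i S) * (\<Prod>j\<in>S. x j))"
    by (intro sum.cong) (auto simp: coeff_deriv_def)
  ultimately show ?thesis unfolding multiaffine_poly_split[OF assms] by simp
qed

lemma has_derivative_multiaffine_poly:
  assumes "i \<in> {1..n}"
  shows "((\<lambda>t. multiaffine_poly n c (x(i := t))) has_real_derivative
    multiaffine_poly n (coeff_deriv i c) x) (at t)"
proof -
  have upd: "(\<Sum>S\<in>Pow ({1..n} - {i}). f S * (\<Prod>j\<in>S. (x(i := t)) j))
      = (\<Sum>S\<in>Pow ({1..n} - {i}). f S * (\<Prod>j\<in>S. x j))" for f t
    by (intro sum.cong refl arg_cong2[of _ _ _ _ "(*)"] prod.cong) auto
  have "multiaffine_poly n c (x(i := t)) = (\<Sum>S\<in>Pow ({1..n} - {i}). c S * (\<Prod>j\<in>S. x j))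
      + t * multiaffine_poly n (coeff_deriv i c) x" for t
    unfolding multiaffine_poly_split[OF assms, of c] multiaffine_poly_coeff_deriv[OF assms] upd
    by simp
  then show ?thesis by (auto intro!: derivative_eq_intros)
qed

lemma partial_deriv_multiaffine_poly:
  assumes "i \<in> {1..n}"
  shows "partial_deriv i (multiaffine_poly n c) = multiaffine_poly n (coeff_deriv i c)"
  unfolding partial_deriv_def
  using DERIV_imp_deriv[OF has_derivative_multiaffine_poly[OF assms]] by blast

lemma foldr_partial_deriv_multiaffine_poly:
  assumes "set xs \<subseteq> {1..n}"
  shows "foldr partial_deriv xs (multiaffine_poly n c) = multiaffine_poly n (foldr coeff_deriv xs c)"
  using assms by (induction xs) (auto simp: partial_deriv_multiaffine_poly)

lemma multiaffine_poly_one: "multiaffine_poly n c (\<lambda>_. 1) = coeff_sum n c"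
  by (simp add: multiaffine_poly_def coeff_sum_def)

lemma coeff_sum_pos_iff:
  assumes "nonneg_coeffs n c"
  shows "0 < coeff_sum n c \<longleftrightarrow> (\<exists>S\<subseteq>{1..n}. c S \<noteq> 0)"
proof -
  have "coeff_sum n c = 0 \<longleftrightarrow> (\<forall>S\<in>Pow {1..n}. c S = 0)"
    unfolding coeff_sum_def using assms
    by (intro sum_nonneg_eq_0_iff) (auto simp: nonneg_coeffs_def)
  then show ?thesis using coeff_sum_nonneg[OF assms] by (auto simp: less_le)
qed

lemma multiaffine_poly_pos:
  assumes "nonneg_coeffs n c" "0 < coeff_sum n c" "\<And>i. i \<in> {1..n} \<Longrightarrow> 0 < x i"
  shows "0 < multiaffine_poly n c x"
proof -
  have pos: "0 < (\<Prod>i\<in>S. x i)" if "S \<subseteq> {1..n}" for S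
    using assms(3) that by (intro prod_pos) auto
  obtain S where "S \<subseteq> {1..n}" "c S \<noteq> 0" using assms coeff_sum_pos_iff by blast
  moreover from this have "0 < c S" using assms(1) by (simp add: nonneg_coeffs_def less_le)
  ultimately show ?thesis
    unfolding multiaffine_poly_def using assms(1) pos
    by (intro sum_pos2[of _ S]) (auto simp: nonneg_coeffs_def less_imp_le)
qed

lemma hessian_ln_multiaffine_poly:
  assumes nonneg: "nonneg_coeffs n c" and pos: "0 < coeff_sum n c"
    and ij: "i \<in> {1..n}" "j \<in> {1..n}"
  shows "hessian (\<lambda>x. ln (multiaffine_poly n c x)) (\<lambda>_. 1) i j
    = (hess_one n c i j * coeff_sum n c - grad_one n c i * grad_one n c j) / (coeff_sum n c)\<^sup>2"
proof -
  have pd: "partial_deriv j (\<lambda>x. ln (multiaffine_poly n c x)) y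
      = multiaffine_poly n (coeff_deriv j c) y / multiaffine_poly n c y"
    if "0 < multiaffine_poly n c y" for y
  proof -
    have "((\<lambda>t. ln (multiaffine_poly n c (y(j := t)))) has_real_derivative
        1 / multiaffine_poly n c (y(j := y j)) * multiaffine_poly n (coeff_deriv j c) y) (at (y j))"
      using that by (intro DERIV_chain2[OF DERIV_ln_divide] has_derivative_multiaffine_poly ij) simp
    then show ?thesis unfolding partial_deriv_def by (simp add: DERIV_imp_deriv)
  qed
  let ?o = "\<lambda>_::nat. 1::real"
  have o: "?o(i := 1) = ?o" by auto
  have "((\<lambda>t. multiaffine_poly n (coeff_deriv j c) (?o(i := t)) / multiaffine_poly n c (?o(i := t)))
      has_real_derivative (hess_one n c i j * coeff_sum n c - grad_one n c j * grad_one n c i)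
        / (coeff_sum n c * coeff_sum n c)) (at 1)"
    using DERIV_divide[OF has_derivative_multiaffine_poly[OF ij(1), of "coeff_deriv j c" ?o 1]
        has_derivative_multiaffine_poly[OF ij(1), of c ?o 1]] pos
    unfolding o multiaffine_poly_one by (simp add: hess_one_def grad_one_def)
  then have "((\<lambda>t. partial_deriv j (\<lambda>x. ln (multiaffine_poly n c x)) (?o(i := t)))
      has_real_derivative (hess_one n c i j * coeff_sum n c - grad_one n c j * grad_one n c i)
        / (coeff_sum n c * coeff_sum n c)) (at 1)"
  proof (rule has_field_derivative_transform_within_open[of _ _ _ "{0<..}"])
    fix t :: real assume "t \<in> {0<..}"
    then have "0 < multiaffine_poly n c (?o(i := t))"
      using nonneg pos by (intro multiaffine_poly_pos) auto
    then show "multiaffine_poly n (coeff_deriv j c) (?o(i := t)) / multiaffine_poly n c (?o(i := t))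
        = partial_deriv j (\<lambda>x. ln (multiaffine_poly n c x)) (?o(i := t))"
      by (rule pd[symmetric])
  qed auto
  then show ?thesis
    unfolding hessian_def partial_deriv_def[of i]
    by (subst DERIV_imp_deriv) (auto simp: power2_eq_square mult_ac)
qed

lemma log_concave_at_one_iff:
  assumes nonneg: "nonneg_coeffs n c" and hom: "homogeneous_coeffs n k c"
  shows "log_concave_at_one n (multiaffine_poly n c) \<longleftrightarrow> hess_nsd_on_grad_perp n c"
proof (cases "coeff_sum n c = 0")
  case True
  then have "c S = 0" if "S \<subseteq> {1..n}" for S
    using coeff_sum_pos_iff[OF nonneg] that by auto
  then have "multiaffine_poly n c x = 0" for x
    unfolding multiaffine_poly_def by (intro sum.neutral) auto
  moreover have "qform {1..n} (hess_one n c) v = 0" for v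
    unfolding qform_def using hess_one_eq_0[OF nonneg True] by (intro sum.neutral ballI) auto
  ultimately show ?thesis by (simp add: log_concave_at_one_def hess_nsd_on_grad_perp_def)
next
  case False
  define p where "p = coeff_sum n c"
  have p: "0 < p" using False coeff_sum_nonneg[OF nonneg] by (simp add: p_def)
  define \<gamma> where "\<gamma> v = (\<Sum>i=1..n. grad_one n c i * v i)" for v
  have form: "(\<Sum>i=1..n. \<Sum>j=1..n. v i * hessian (\<lambda>x. ln (multiaffine_poly n c x)) (\<lambda>_. 1) i j * v j)
      = (p * qform {1..n} (hess_one n c) v - (\<gamma> v)\<^sup>2) / p\<^sup>2" for v
  proof -
    have "(\<Sum>i=1..n. \<Sum>j=1..n. v i * hessian (\<lambda>x. ln (multiaffine_poly n c x)) (\<lambda>_. 1) i j * v j)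
        = (\<Sum>i=1..n. \<Sum>j=1..n. (v i * (p * hess_one n c i j) * v j
            - (grad_one n c i * v i) * (grad_one n c j * v j)) / p\<^sup>2)"
      using p unfolding p_def
      by (intro sum.cong refl) (simp add: hessian_ln_multiaffine_poly[OF nonneg] algebra_simps)
    also have "\<dots> = (qform {1..n} (\<lambda>i j. p * hess_one n c i j) v - (\<gamma> v)\<^sup>2) / p\<^sup>2"
      unfolding qform_def \<gamma>_def power2_eq_square[of "sum _ _"] sum_product
      by (simp add: sum_divide_distrib[symmetric] sum_subtractf[symmetric])
    finally show ?thesis unfolding qform_cmult .
  qed
  have "multiaffine_poly n c (\<lambda>_. 1) \<noteq> 0" using False by (simp add: multiaffine_poly_one)
  then have "log_concave_at_one n (multiaffine_poly n c)
      \<longleftrightarrow> (\<forall>v. p * qform {1..n} (hess_one n c) v \<le> (\<gamma> v)\<^sup>2)"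
    unfolding log_concave_at_one_def neg_semidefinite_def form using p
    by (auto simp: divide_le_0_iff)
  also have "\<dots> \<longleftrightarrow> hess_nsd_on_grad_perp n c"
  proof
    assume *: "\<forall>v. p * qform {1..n} (hess_one n c) v \<le> (\<gamma> v)\<^sup>2"
    have "qform {1..n} (hess_one n c) v \<le> 0" if "\<gamma> v = 0" for v
      using *[rule_format, of v] that p by (simp add: mult_le_0_iff)
    then show "hess_nsd_on_grad_perp n c" by (simp add: hess_nsd_on_grad_perp_def \<gamma>_def)
  next
    assume nsd: "hess_nsd_on_grad_perp n c"
    show "\<forall>v. p * qform {1..n} (hess_one n c) v \<le> (\<gamma> v)\<^sup>2"
    proof
      fix v
      show "p * qform {1..n} (hess_one n c) v \<le> (\<gamma> v)\<^sup>2"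
      proof (cases "k = 0")
        case True
        have "(\<Sum>i=1..n. grad_one n c i) = 0" using sum_grad_one[OF hom] True by simp
        then have "grad_one n c i = 0" if "i \<in> {1..n}" for i
          using grad_one_nonneg[OF nonneg] that by (subst (asm) sum_nonneg_eq_0_iff) auto
        then have "\<gamma> v = 0" unfolding \<gamma>_def by (intro sum.neutral) auto
        then have "qform {1..n} (hess_one n c) v \<le> 0"
          using nsd by (simp add: hess_nsd_on_grad_perp_def \<gamma>_def)
        then show ?thesis using p \<open>\<gamma> v = 0\<close> by (simp add: mult_le_0_iff)
      next
        case False
        have "real k * (p * qform {1..n} (hess_one n c) v) \<le> (real k - 1) * (\<gamma> v)\<^sup>2"
          using hess_nsd_bound[OF nsd nonneg hom, of v] False
          by (simp add: p_def \<gamma>_def mult.assoc)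
        also have "\<dots> \<le> real k * (\<gamma> v)\<^sup>2" by (intro mult_right_mono) auto
        finally show ?thesis using False by simp
      qed
    qed
  qed
  finally show ?thesis .
qed

section \<open>Powers of the coefficients\<close>

lemma coeff_sum_powr_pos_iff:
  assumes "nonneg_coeffs n c"
  shows "0 < coeff_sum n (\<lambda>S. c S powr \<alpha>) \<longleftrightarrow> 0 < coeff_sum n c"
proof -
  have "nonneg_coeffs n (\<lambda>S. c S powr \<alpha>)" by (simp add: nonneg_coeffs_def)
  then show ?thesis using assms by (simp add: coeff_sum_pos_iff)
qed

lemma grad_one_powr_pos_iff:
  assumes "nonneg_coeffs n c" "i \<in> {1..n}"
  shows "0 < grad_one n (\<lambda>S. c S powr \<alpha>) i \<longleftrightarrow> 0 < grad_one n c i"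
  unfolding grad_one_def coeff_deriv_powr using assms
  by (intro coeff_sum_powr_pos_iff nonneg_coeff_deriv)

lemma hess_one_powr_pos_iff:
  assumes "nonneg_coeffs n c" "i \<in> {1..n}" "j \<in> {1..n}"
  shows "0 < hess_one n (\<lambda>S. c S powr \<alpha>) i j \<longleftrightarrow> 0 < hess_one n c i j"
  unfolding hess_one_def coeff_deriv_powr using assms
  by (intro coeff_sum_powr_pos_iff nonneg_coeff_deriv)

lemma coeff_sum_homogeneous_0:
  assumes "homogeneous_coeffs n 0 c"
  shows "coeff_sum n c = c {}"
proof -
  have "c S = 0" if "S \<in> Pow {1..n} - {{}}" for S
    using assms that finite_subset[of S "{1..n}"] by (auto simp: homogeneous_coeffs_def)
  then have "coeff_sum n c = (\<Sum>S\<in>{{}}. c S)"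
    unfolding coeff_sum_def by (intro sum.mono_neutral_right) auto
  then show ?thesis by simp
qed

lemma homogeneous_coeffs_powr:
  "homogeneous_coeffs n k c \<Longrightarrow> homogeneous_coeffs n k (\<lambda>S. c S powr \<alpha>)"
  by (simp add: homogeneous_coeffs_def)

lemma hess_nsd_powr_degree_2:
  assumes nonneg: "nonneg_coeffs n c" and hom: "homogeneous_coeffs n 2 c"
    and nsd: "hess_nsd_on_grad_perp n c" and \<alpha>: "0 \<le> \<alpha>" "\<alpha> \<le> 1"
  shows "hess_nsd_on_grad_perp n (\<lambda>S. c S powr \<alpha>)"
proof -
  have grad: "grad_one n d i = (\<Sum>j=1..n. hess_one n d i j)"
    if "homogeneous_coeffs n 2 d" "i \<in> {1..n}" for d i
    using sum_hess_one[OF that] by simp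
  have hess: "hess_one n (\<lambda>S. c S powr \<alpha>) i j = hess_one n c i j powr \<alpha>"
    if "i \<in> {1..n}" "j \<in> {1..n}" for i j
  proof -
    have "homogeneous_coeffs n (2 - 1 - 1) (coeff_deriv i (coeff_deriv j c))"
      using hom that by (intro homogeneous_coeff_deriv)
    then have h: "homogeneous_coeffs n 0 (coeff_deriv i (coeff_deriv j c))" by simp
    show ?thesis
      unfolding hess_one_def coeff_deriv_powr
      by (simp add: coeff_sum_homogeneous_0[OF h]
          coeff_sum_homogeneous_0[OF homogeneous_coeffs_powr[OF h]])
  qed
  show ?thesis
    unfolding hess_nsd_on_grad_perp_def
  proof (intro allI impI)
    fix v assume v: "(\<Sum>i=1..n. grad_one n (\<lambda>S. c S powr \<alpha>) i * v i) = 0"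
    have "qform {1..n} (\<lambda>i j. hess_one n c i j powr \<alpha>) v \<le> 0"
    proof (rule hadamard_powr_nsd)
      show "hess_one n c i i = 0" for i
        unfolding hess_one_def coeff_sum_def by (intro sum.neutral) (simp add: coeff_deriv_def)
      show "qform {1..n} (hess_one n c) u \<le> 0"
        if u: "(\<Sum>i=1..n. u i * (\<Sum>j=1..n. hess_one n c i j)) = 0" for u
      proof -
        have "(\<Sum>i=1..n. grad_one n c i * u i) = (\<Sum>i=1..n. u i * (\<Sum>j=1..n. hess_one n c i j))"
          by (intro sum.cong refl) (simp only: grad[OF hom] mult.commute)
        then show ?thesis using nsd u by (simp add: hess_nsd_on_grad_perp_def)
      qed
      have "(\<Sum>i=1..n. v i * (\<Sum>j=1..n. hess_one n c i j powr \<alpha>))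
          = (\<Sum>i=1..n. grad_one n (\<lambda>S. c S powr \<alpha>) i * v i)"
      proof (intro sum.cong refl)
        fix i assume i: "i \<in> {1..n}"
        have "(\<Sum>j=1..n. hess_one n c i j powr \<alpha>) = (\<Sum>j=1..n. hess_one n (\<lambda>S. c S powr \<alpha>) i j)"
          using hess[OF i] by (intro sum.cong) auto
        then show "v i * (\<Sum>j=1..n. hess_one n c i j powr \<alpha>) = grad_one n (\<lambda>S. c S powr \<alpha>) i * v i"
          by (simp only: grad[OF homogeneous_coeffs_powr[OF hom] i] mult.commute)
      qed
      then show "(\<Sum>i=1..n. v i * (\<Sum>j=1..n. hess_one n c i j powr \<alpha>)) = 0" using v by simp
    qed (use \<alpha> hess_one_nonneg[OF nonneg] hess_one_sym in auto)
    also have "qform {1..n} (\<lambda>i j. hess_one n c i j powr \<alpha>) v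
        = qform {1..n} (hess_one n (\<lambda>S. c S powr \<alpha>)) v"
      by (intro qform_cong) (simp add: hess)
    finally show "qform {1..n} (hess_one n (\<lambda>S. c S powr \<alpha>)) v \<le> 0" .
  qed
qed

lemma hess_nsd_degree_le_1:
  assumes "nonneg_coeffs n c" "homogeneous_coeffs n k c" "k \<le> 1"
  shows "hess_nsd_on_grad_perp n c"
proof -
  have "hess_one n c i j = 0" if "i \<in> {1..n}" "j \<in> {1..n}" for i j
  proof -
    have "(\<Sum>j=1..n. hess_one n c i j) = 0" using sum_hess_one[OF assms(2) that(1)] assms(3) by simp
    then show ?thesis
      using hess_one_nonneg[OF assms(1) that(1)] that(2)
      by (subst (asm) sum_nonneg_eq_0_iff) auto
  qed
  then have "qform {1..n} (hess_one n c) v = 0" for v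
    unfolding qform_def by (intro sum.neutral ballI) auto
  then show ?thesis by (simp add: hess_nsd_on_grad_perp_def)
qed

lemma hess_nsd_powr:
  assumes "nonneg_coeffs n c" "homogeneous_coeffs n k c"
    and "\<And>xs. set xs \<subseteq> {1..n} \<Longrightarrow> hess_nsd_on_grad_perp n (foldr coeff_deriv xs c)"
    and \<alpha>: "0 \<le> \<alpha>" "\<alpha> \<le> 1"
  shows "hess_nsd_on_grad_perp n (\<lambda>S. c S powr \<alpha>)"
  using assms(1-3)
proof (induction k arbitrary: c)
  case 0
  then show ?case
    by (intro hess_nsd_degree_le_1[OF _ homogeneous_coeffs_powr]) (auto simp: nonneg_coeffs_def)
next
  case (Suc k)
  let ?d = "\<lambda>S. c S powr \<alpha>"
  have nsd: "hess_nsd_on_grad_perp n c" using Suc.prems(3)[of "[]"] by simp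
  have nonneg': "nonneg_coeffs n ?d" by (simp add: nonneg_coeffs_def)
  have hom': "homogeneous_coeffs n (Suc k) ?d" by (rule homogeneous_coeffs_powr) (rule Suc.prems)
  consider "k = 0" | "k = 1" | "3 \<le> Suc k" by linarith
  then show ?case
  proof cases
    case 1
    then show ?thesis using hess_nsd_degree_le_1[OF nonneg' hom'] by simp
  next
    case 2
    then show ?thesis
      using Suc.prems nsd \<alpha> by (intro hess_nsd_powr_degree_2) (auto simp: numeral_2_eq_2)
  next
    case 3
    have V: "{i\<in>{1..n}. 0 < grad_one n ?d i} = {i\<in>{1..n}. 0 < grad_one n c i}"
      using grad_one_powr_pos_iff[OF Suc.prems(1)] by blast
    show ?thesis
    proof (rule hess_nsd_trickle_down[OF nonneg' hom' 3])
      fix i assume i: "i \<in> {1..n}"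
      have "hess_nsd_on_grad_perp n (\<lambda>S. coeff_deriv i c S powr \<alpha>)"
      proof (rule Suc.IH)
        show "homogeneous_coeffs n k (coeff_deriv i c)"
          using homogeneous_coeff_deriv[OF Suc.prems(2) i] by simp
        show "hess_nsd_on_grad_perp n (foldr coeff_deriv xs (coeff_deriv i c))"
          if "set xs \<subseteq> {1..n}" for xs
          using Suc.prems(3)[of "xs @ [i]"] that i by simp
      qed (rule nonneg_coeff_deriv[OF Suc.prems(1) i])
      then show "hess_nsd_on_grad_perp n (coeff_deriv i ?d)" by (simp only: coeff_deriv_powr)
    next
      fix X assume X: "X \<subset> {i\<in>{1..n}. 0 < grad_one n ?d i}" "X \<noteq> {}"
      have "2 \<le> Suc k" using 3 by simp
      then obtain i j where ij: "i \<in> X" "j \<in> {i\<in>{1..n}. 0 < grad_one n c i} - X" "0 < hess_one n c i j"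
        using hess_one_connected[OF nsd Suc.prems(1,2)] X unfolding V by meson
      moreover have "0 < hess_one n ?d i j"
        using hess_one_powr_pos_iff[OF Suc.prems(1), of i j] ij X by blast
      ultimately show "\<exists>i\<in>X. \<exists>j\<in>{i\<in>{1..n}. 0 < grad_one n ?d i} - X. 0 < hess_one n ?d i j"
        unfolding V by blast
    qed
  qed
qed

theorem theorem1p7:
  fixes n k :: nat and c :: "nat set \<Rightarrow> real" and \<alpha> :: real
  assumes nonneg: "\<And>S. S \<subseteq> {1..n} \<Longrightarrow> 0 \<le> c S"
    and homogeneous: "\<And>S. S \<subseteq> {1..n} \<Longrightarrow> c S \<noteq> 0 \<Longrightarrow> card S = k"
    and slc: "strongly_log_concave_at_one n (multiaffine_poly n c)"
    and "0 \<le> \<alpha>" and "\<alpha> \<le> 1"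
  shows "strongly_log_concave_at_one n (multiaffine_poly n (\<lambda>S. c S powr \<alpha>))"
proof -
  have nonneg_foldr: "nonneg_coeffs n (foldr coeff_deriv xs c)" if "set xs \<subseteq> {1..n}" for xs
    using that
  proof (induction xs)
    case Nil
    then show ?case using nonneg by (simp add: nonneg_coeffs_def)
  next
    case (Cons x xs)
    then show ?case by (simp add: nonneg_coeff_deriv)
  qed
  have hom_foldr: "homogeneous_coeffs n (k - length xs) (foldr coeff_deriv xs c)"
    if "set xs \<subseteq> {1..n}" for xs
    using that
  proof (induction xs)
    case Nil
    then show ?case using homogeneous by (simp add: homogeneous_coeffs_def)
  next
    case (Cons x xs)
    then have "homogeneous_coeffs n (k - length xs - 1) (coeff_deriv x (foldr coeff_deriv xs c))"
      by (intro homogeneous_coeff_deriv) auto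
    then show ?case by simp
  qed
  have nsd: "hess_nsd_on_grad_perp n (foldr coeff_deriv xs c)" if "set xs \<subseteq> {1..n}" for xs
    using slc[unfolded strongly_log_concave_at_one_def, rule_format, OF that]
      log_concave_at_one_iff[OF nonneg_foldr[OF that] hom_foldr[OF that]]
    by (simp only: foldr_partial_deriv_multiaffine_poly[OF that])
  have foldr_powr: "foldr coeff_deriv xs (\<lambda>S. c S powr \<alpha>) = (\<lambda>S. foldr coeff_deriv xs c S powr \<alpha>)" for xs
    by (induction xs) (simp_all add: coeff_deriv_powr)
  show ?thesis
    unfolding strongly_log_concave_at_one_def
  proof (intro allI impI)
    fix xs :: "nat list" assume xs: "set xs \<subseteq> {1..n}"
    let ?c = "foldr coeff_deriv xs c"
    have "hess_nsd_on_grad_perp n (\<lambda>S. ?c S powr \<alpha>)"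
    proof (rule hess_nsd_powr[OF nonneg_foldr[OF xs] hom_foldr[OF xs] _ \<open>0 \<le> \<alpha>\<close> \<open>\<alpha> \<le> 1\<close>])
      show "hess_nsd_on_grad_perp n (foldr coeff_deriv ys ?c)" if "set ys \<subseteq> {1..n}" for ys
        using nsd[of "ys @ xs"] that xs by simp
    qed
    then show "log_concave_at_one n (foldr partial_deriv xs (multiaffine_poly n (\<lambda>S. c S powr \<alpha>)))"
      unfolding foldr_partial_deriv_multiaffine_poly[OF xs] foldr_powr
      by (subst log_concave_at_one_iff[OF _ homogeneous_coeffs_powr[OF hom_foldr[OF xs]]])
        (simp_all add: nonneg_coeffs_def)
  qed
qed

end
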